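(* Let $(L,v)$ be a henselian non-trivially valued field whose residue field $Lv$ has characteristic $0$, and suppose that the value group $vL$ does not have a maximal proper convex subgroup. Then for each integer $n\geq 1$ there is a subfield $K$ of $L$, dense in $(L,v)$, such that $(K,v)$ is henselian and $\mathrm{trdeg}\, L|K=n$; and there is also a subfield $K$ of $L$, dense in $(L,v)$, such that $(K,v)$ is not henselian and $\mathrm{trdeg}\, L|K=n$. Likewise, a henselian (as well as a non-henselian) dense subfield $K$ of $(L,v)$ can be chosen such that $\mathrm{trdeg}\, L|K$ is infinite.
   Context: Valuations are Krull valuations (arbitrary ordered abelian value groups), written additively; $vL$ denotes the value group and $Lv$ the residue field of $(L,v)$. A subfield $K$ of $L$ is dense in $(L,v)$ if for every $a\in L$ and every $\alpha\in vL$ there is $b\in K$ with $v(a-b)\geq\alpha$. A subfield $K$ of $L$ is equipped with the restriction of $v$. *)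

theory Defs
  imports
    "HOL-Library.Extended"
    "HOL-Library.Extended_Nat"
    "HOL-Library.Poly_Mapping"
    "HOL-Computational_Algebra.Polynomial"
    "HOL-Algebra.Subrings"
    "HOL-Algebra.QuotRing"
begin

text \<open>
  The big field is the whole type \<open>'a :: field\<close>; subfields and other subrings are subsets of it.
  \<open>ring_on S\<close> is the view of such a subset as a HOL-Algebra structure.
\<close>

definition ring_on :: "'a::comm_ring_1 set \<Rightarrow> 'a ring" where
  "ring_on S = \<lparr>carrier = S, monoid.mult = (*), one = 1, zero = 0, add = (+)\<rparr>"

text \<open>
  Only the values \<open>Fin g\<close> and \<open>Pinf\<close> of \<open>'g extended\<close> are taken; \<open>Minf\<close> is excluded by the
  second axiom. The valuation need not be onto: the value group may be a proper subgroup of \<open>'g\<close>.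
\<close>

definition valuation :: "('a::field \<Rightarrow> 'g::linordered_ab_group_add extended) \<Rightarrow> bool" where
  "valuation v \<longleftrightarrow>
     (\<forall>x. v x = Pinf \<longleftrightarrow> x = 0) \<and>
     (\<forall>x. v x \<noteq> Minf) \<and>
     (\<forall>x y. v (x * y) = v x + v y) \<and>
     (\<forall>x y. min (v x) (v y) \<le> v (x + y))"

definition value_group :: "('a \<Rightarrow> 'g extended) \<Rightarrow> 'g set" where
  "value_group v = {g. \<exists>x. v x = Fin g}"

definition valuation_ring :: "('a \<Rightarrow> 'g::linordered_ab_group_add extended) \<Rightarrow> 'a set" where
  "valuation_ring v = {x. 0 \<le> v x}"

definition valuation_ideal :: "('a \<Rightarrow> 'g::linordered_ab_group_add extended) \<Rightarrow> 'a set" where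
  "valuation_ideal v = {x. 0 < v x}"

definition residue_field ::
    "('a::field \<Rightarrow> 'g::linordered_ab_group_add extended) \<Rightarrow> 'a set ring" where
  "residue_field v = ring_on (valuation_ring v) Quot valuation_ideal v"

definition characteristic_zero :: "('a, 'b) ring_scheme \<Rightarrow> bool" where
  "characteristic_zero R \<longleftrightarrow> (\<forall>n::nat. 0 < n \<longrightarrow> [n] \<cdot>\<^bsub>R\<^esub> \<one>\<^bsub>R\<^esub> \<noteq> \<zero>\<^bsub>R\<^esub>)"

definition convex_subgroup :: "'g::linordered_ab_group_add set \<Rightarrow> 'g set \<Rightarrow> bool" where
  "convex_subgroup C G \<longleftrightarrow>
     C \<subseteq> G \<and> 0 \<in> C \<and> (\<forall>a\<in>C. \<forall>b\<in>C. a - b \<in> C) \<and>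
     (\<forall>a\<in>C. \<forall>c\<in>C. \<forall>b\<in>G. a \<le> b \<and> b \<le> c \<longrightarrow> b \<in> C)"

definition maximal_proper_convex_subgroup ::
    "'g::linordered_ab_group_add set \<Rightarrow> 'g set \<Rightarrow> bool" where
  "maximal_proper_convex_subgroup C G \<longleftrightarrow>
     convex_subgroup C G \<and> C \<noteq> G \<and>
     (\<forall>D. convex_subgroup D G \<and> D \<noteq> G \<and> C \<subseteq> D \<longrightarrow> D = C)"

text \<open>
  Hensel's Lemma for the field \<open>K\<close> with the restriction of \<open>v\<close>, whose valuation ring is
  \<open>K \<inter> valuation_ring v\<close>.
\<close>

definition henselian ::
    "('a::field \<Rightarrow> 'g::linordered_ab_group_add extended) \<Rightarrow> 'a set \<Rightarrow> bool" where
  "henselian v K \<longleftrightarrow>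
     (\<forall>f::'a poly. \<forall>b. (\<forall>i. Polynomial.coeff f i \<in> K \<inter> valuation_ring v) \<longrightarrow>
        b \<in> K \<inter> valuation_ring v \<longrightarrow> 0 < v (poly f b) \<longrightarrow> v (poly (pderiv f) b) = 0 \<longrightarrow>
        (\<exists>a \<in> K \<inter> valuation_ring v. poly f a = 0 \<and> 0 < v (a - b)))"

definition dense_in_valued ::
    "('a::field \<Rightarrow> 'g::linordered_ab_group_add extended) \<Rightarrow> 'a set \<Rightarrow> bool" where
  "dense_in_valued v K \<longleftrightarrow> (\<forall>a. \<forall>\<alpha>\<in>value_group v. \<exists>b\<in>K. Fin \<alpha> \<le> v (a - b))"

text \<open>
  Multivariate polynomials are finitely supported maps from monomials (themselves finitely
  supported maps from variables to exponents) to coefficients. The variables are named by the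
  field elements that are substituted for them.
\<close>

definition mpoly_eval :: "(('a \<Rightarrow>\<^sub>0 nat) \<Rightarrow>\<^sub>0 'a) \<Rightarrow> 'a::comm_ring_1" where
  "mpoly_eval p =
     (\<Sum>m\<in>Poly_Mapping.keys p.
        Poly_Mapping.lookup p m * (\<Prod>b\<in>Poly_Mapping.keys m. b ^ Poly_Mapping.lookup m b))"

definition algebraically_independent :: "'a::field set \<Rightarrow> 'a set \<Rightarrow> bool" where
  "algebraically_independent K B \<longleftrightarrow>
     (\<forall>p :: ('a \<Rightarrow>\<^sub>0 nat) \<Rightarrow>\<^sub>0 'a.
        (\<forall>m. Poly_Mapping.lookup p m \<in> K) \<longrightarrow>
        (\<forall>m\<in>Poly_Mapping.keys p. Poly_Mapping.keys m \<subseteq> B) \<longrightarrow>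
        mpoly_eval p = 0 \<longrightarrow> p = 0)"

text \<open>
  The transcendence degree of the field \<open>L\<close> over its subfield \<open>K\<close>: the greatest cardinality of
  a subset of \<open>L\<close> algebraically independent over \<open>K\<close>, all infinite cardinals being identified.
  A subset of an independent set is independent, so finite sets suffice.
\<close>

definition trdeg :: "'a::field set \<Rightarrow> 'a set \<Rightarrow> enat" where
  "trdeg L K = (SUP B \<in> {B. B \<subseteq> L \<and> finite B \<and> algebraically_independent K B}. enat (card B))"

end

theory Submission
  imports Defs "HOL-Algebra.Finite_Extensions"
begin

text \<open>
  Write \<open>L\<close> for the whole field, and \<open>acl A\<close> for the set of its elements that are algebraic over
  the subring generated by \<open>A\<close>. This closure operator is a pregeometry, so transcendence degrees
  can be computed with independent sets (\<open>trdeg_eq_card_basis\<close>), and a set that is independent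
  over some \<open>D\<close> is a transcendence basis of \<open>L\<close> over a suitable \<open>K \<supseteq> D\<close> with \<open>acl K = K\<close>
  (\<open>exists_spanning_complement\<close>). The problem is to make such a \<open>K\<close> dense.

  As the value group has no maximal proper convex subgroup, above every archimedean class of
  positive values there is a larger one (\<open>exists_arch_greater\<close>). Hence there is a set \<open>S\<close> of
  elements of positive value in pairwise distinct archimedean classes, together with a partition
  of \<open>S\<close> into countably many parts, each of which contains elements of arbitrarily large value
  (\<open>exists_cofinal_families\<close>). Since the residue characteristic is \<open>0\<close>, nonzero integers are units
  of the valuation ring, and in a polynomial expression in elements of \<open>S\<close> a single monomial
  dominates all others; so \<open>S\<close> is algebraically independent (\<open>arch_chain_independent\<close>).

  Choose one element \<open>y k\<close> in the \<open>k\<close>-th part, and let \<open>D\<close> consist of the differences \<open>y k - s\<close> for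
  the other elements \<open>s\<close> of that part, for all \<open>k\<close>. Exchanging \<open>s\<close> for \<open>y k - s\<close> does not affect
  independence, so the \<open>y k\<close> are independent over \<open>D\<close>. But each \<open>y k\<close> is a limit of elements of
  \<open>D \<union> {0}\<close>, because \<open>s\<close> can have arbitrarily large value (\<open>exists_independent_limits\<close>).

  Let \<open>Y\<close> be any set of elements \<open>y k\<close>, and \<open>K \<supseteq> D \<union> {0}\<close> with \<open>acl K = K\<close> and with \<open>Y\<close> as a
  transcendence basis of \<open>L\<close> over \<open>K\<close>. By Hensel's Lemma the topological closure of \<open>K\<close> is
  relatively algebraically closed in \<open>L\<close> (\<open>acl_vclosure\<close>): a simple root of a polynomial is
  approximated by roots of approximating polynomials. The closure contains \<open>K\<close> and \<open>Y\<close>, so it is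
  \<open>L\<close>, and \<open>K\<close> is dense. It is henselian, being relatively algebraically closed in \<open>L\<close>, and the
  transcendence degree of \<open>L\<close> over \<open>K\<close> is the cardinality of \<open>Y\<close>, which can be prescribed.

  For the non-henselian fields, take such a \<open>K\<close> for a basis \<open>{y 0} \<union> Y\<close> with \<open>y 0 \<notin> Y\<close>, and pass to
  \<open>K (y 0)\<close>. It is still dense, \<open>Y\<close> is a transcendence basis of \<open>L\<close> over it, and it is not
  henselian: \<open>1 + y 0\<close> is a square in every henselian subfield that contains it, but not in a
  rational function field with \<open>y 0\<close> as the variable
  (\<open>not_henselian_simple_transcendental\<close>).
\<close>

section \<open>Algebraic closure inside a field\<close>

inductive_set ring_gen :: "'a::comm_ring_1 set \<Rightarrow> 'a set" for A where
  base: "a \<in> A \<Longrightarrow> a \<in> ring_gen A"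
| one: "1 \<in> ring_gen A"
| diff: "a \<in> ring_gen A \<Longrightarrow> b \<in> ring_gen A \<Longrightarrow> a - b \<in> ring_gen A"
| mult: "a \<in> ring_gen A \<Longrightarrow> b \<in> ring_gen A \<Longrightarrow> a * b \<in> ring_gen A"

lemma ring_gen_zero: "0 \<in> ring_gen A"
  using ring_gen.diff[OF ring_gen.one ring_gen.one, of A] by simp

lemma ring_gen_uminus: "a \<in> ring_gen A \<Longrightarrow> - a \<in> ring_gen A"
  using ring_gen.diff[OF ring_gen_zero] by fastforce

lemma ring_gen_add: "a \<in> ring_gen A \<Longrightarrow> b \<in> ring_gen A \<Longrightarrow> a + b \<in> ring_gen A"
  using ring_gen.diff[of a A "- b"] ring_gen_uminus by fastforce

lemma ring_gen_mono: "A \<subseteq> B \<Longrightarrow> ring_gen A \<subseteq> ring_gen B"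
proof
  fix x assume "A \<subseteq> B" "x \<in> ring_gen A"
  from this(2) show "x \<in> ring_gen B"
    by induction (use \<open>A \<subseteq> B\<close> in \<open>auto intro: ring_gen.intros\<close>)
qed

lemma ring_gen_least:
  assumes "A \<subseteq> R" "1 \<in> R" "\<And>a b. a \<in> R \<Longrightarrow> b \<in> R \<Longrightarrow> a - b \<in> R"
    "\<And>a b. a \<in> R \<Longrightarrow> b \<in> R \<Longrightarrow> a * b \<in> R"
  shows "ring_gen A \<subseteq> R"
proof
  fix x assume "x \<in> ring_gen A"
  then show "x \<in> R" by induction (use assms in auto)
qed

lemma ring_gen_finite_subset:
  "x \<in> ring_gen A \<Longrightarrow> \<exists>F. finite F \<and> F \<subseteq> A \<and> x \<in> ring_gen F"
proof (induction rule: ring_gen.induct)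
  case (base a)
  then show ?case by (intro exI[of _ "{a}"]) (auto intro: ring_gen.base)
next
  case one
  then show ?case by (intro exI[of _ "{}"]) (auto intro: ring_gen.one)
next
  case (diff a b)
  then obtain F G where "finite F" "F \<subseteq> A" "a \<in> ring_gen F" "finite G" "G \<subseteq> A" "b \<in> ring_gen G"
    by blast
  then show ?case
    using ring_gen_mono[of F "F \<union> G"] ring_gen_mono[of G "F \<union> G"]
    by (intro exI[of _ "F \<union> G"]) (auto intro: ring_gen.diff)
next
  case (mult a b)
  then obtain F G where "finite F" "F \<subseteq> A" "a \<in> ring_gen F" "finite G" "G \<subseteq> A" "b \<in> ring_gen G"
    by blast
  then show ?case
    using ring_gen_mono[of F "F \<union> G"] ring_gen_mono[of G "F \<union> G"]
    by (intro exI[of _ "F \<union> G"]) (auto intro: ring_gen.mult)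
qed

lemma ring_gen_sum: "(\<And>i. i \<in> I \<Longrightarrow> f i \<in> ring_gen A) \<Longrightarrow> sum f I \<in> ring_gen A"
  by (induction I rule: infinite_finite_induct) (auto intro: ring_gen_zero ring_gen_add)

lemma ring_gen_power: "a \<in> ring_gen A \<Longrightarrow> a ^ n \<in> ring_gen A"
  by (induction n) (auto intro: ring_gen.intros)

definition poly_over :: "'a::zero set \<Rightarrow> 'a poly \<Rightarrow> bool" where
  "poly_over R p \<longleftrightarrow> (\<forall>i. Polynomial.coeff p i \<in> R)"

lemma poly_over_pCons: "0 \<in> R \<Longrightarrow> poly_over R (pCons a p) \<longleftrightarrow> a \<in> R \<and> poly_over R p"
  by (auto simp: poly_over_def coeff_pCons split: nat.splits)

lemma poly_over_mono: "R \<subseteq> S \<Longrightarrow> poly_over R p \<Longrightarrow> poly_over S p"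
  by (auto simp: poly_over_def)

lemma poly_over_finite_subset:
  assumes "poly_over (ring_gen A) p"
  shows "\<exists>F. finite F \<and> F \<subseteq> A \<and> poly_over (ring_gen F) p"
  using assms
proof (induction p)
  case 0
  then show ?case
    by (intro exI[of _ "{}"]) (auto simp: poly_over_def ring_gen_zero)
next
  case (pCons a p)
  then obtain F where F: "finite F" "F \<subseteq> A" "poly_over (ring_gen F) p"
    by (auto simp: poly_over_pCons ring_gen_zero)
  obtain G where G: "finite G" "G \<subseteq> A" "a \<in> ring_gen G"
    using pCons by (auto simp: poly_over_pCons ring_gen_zero dest: ring_gen_finite_subset)
  have "poly_over (ring_gen (F \<union> G)) (pCons a p)"
    using F G poly_over_mono[OF ring_gen_mono[of F "F \<union> G"]] ring_gen_mono[of G "F \<union> G"]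
    by (auto simp: poly_over_pCons ring_gen_zero)
  then show ?case using F G by blast
qed

lemma ring_gen_insert:
  "ring_gen (insert y A) = {poly q y | q. poly_over (ring_gen A) q}"
proof
  have one: "poly_over (ring_gen A) 1"
    unfolding one_pCons by (simp add: poly_over_pCons ring_gen_zero ring_gen.one) (simp add: poly_over_def ring_gen_zero)
  show "ring_gen (insert y A) \<subseteq> {poly q y | q. poly_over (ring_gen A) q}"
  proof (rule ring_gen_least)
    show "insert y A \<subseteq> {poly q y |q. poly_over (ring_gen A) q}"
    proof
      fix x assume "x \<in> insert y A"
      then consider "x = y" | "x \<in> A" by blast
      then show "x \<in> {poly q y |q. poly_over (ring_gen A) q}"
      proof cases
        case 1
        then show ?thesis
          by (intro CollectI exI[of _ "[:0, 1:]"])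
            (simp add: poly_over_pCons ring_gen_zero ring_gen.one, simp add: poly_over_def ring_gen_zero)
      next
        case 2
        then show ?thesis
          by (intro CollectI exI[of _ "[:x:]"])
            (simp add: poly_over_pCons ring_gen_zero ring_gen.base, simp add: poly_over_def ring_gen_zero)
      qed
    qed
    show "1 \<in> {poly q y |q. poly_over (ring_gen A) q}"
      using one by (intro CollectI exI[of _ 1]) auto
  next
    fix a b assume "a \<in> {poly q y |q. poly_over (ring_gen A) q}" "b \<in> {poly q y |q. poly_over (ring_gen A) q}"
    then obtain p q where pq: "a = poly p y" "b = poly q y" "poly_over (ring_gen A) p" "poly_over (ring_gen A) q"
      by auto
    then show "a - b \<in> {poly q y |q. poly_over (ring_gen A) q}"
      by (intro CollectI exI[of _ "p - q"]) (auto simp: poly_over_def intro: ring_gen.diff)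
    from pq show "a * b \<in> {poly q y |q. poly_over (ring_gen A) q}"
      by (intro CollectI exI[of _ "p * q"])
        (auto simp: poly_over_def coeff_mult intro!: ring_gen_sum ring_gen.mult)
  qed
  show "{poly q y | q. poly_over (ring_gen A) q} \<subseteq> ring_gen (insert y A)"
    using ring_gen_mono[OF subset_insertI[of A y]]
    by (auto simp: poly_over_def poly_altdef intro!: ring_gen_sum ring_gen.mult ring_gen_power intro: ring_gen.base)
qed

definition algebraic_over :: "'a::comm_ring_1 set \<Rightarrow> 'a \<Rightarrow> bool" where
  "algebraic_over R x \<longleftrightarrow> (\<exists>p. p \<noteq> 0 \<and> poly_over R p \<and> poly p x = 0)"

text \<open>
  Algebraicity over the generated subring is the same as over the generated subfield, see
  \<open>acl_eq_algebraic_over_fractions\<close>. The subring is the more convenient choice because its elements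
  are polynomial expressions in the generators, without denominators.
\<close>

definition acl :: "'a::field set \<Rightarrow> 'a set" where
  "acl A = {x. algebraic_over (ring_gen A) x}"

lemma algebraic_over_mono: "R \<subseteq> S \<Longrightarrow> algebraic_over R x \<Longrightarrow> algebraic_over S x"
  unfolding algebraic_over_def using poly_over_mono by blast

subsection \<open>Transitivity\<close>

lemma ring_on_simps [simp]:
  "carrier (ring_on S) = S" "x \<otimes>\<^bsub>ring_on S\<^esub> y = x * y" "x \<oplus>\<^bsub>ring_on S\<^esub> y = x + y"
  "\<one>\<^bsub>ring_on S\<^esub> = 1" "\<zero>\<^bsub>ring_on S\<^esub> = 0"
  by (simp_all add: ring_on_def)

lemma ring_on_UNIV_field: "field (ring_on (UNIV :: 'a::field set))"
proof (rule cring.cring_fieldI2)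
  show "cring (ring_on (UNIV :: 'a set))"
  proof (rule cringI)
    show "abelian_group (ring_on (UNIV :: 'a set))"
      by (rule abelian_groupI) (auto simp: algebra_simps intro: exI[of _ "- _"] )
    show "Group.comm_monoid (ring_on (UNIV :: 'a set))"
      by (rule comm_monoidI) (auto simp: algebra_simps)
  qed (auto simp: algebra_simps)
  show "\<zero>\<^bsub>ring_on (UNIV :: 'a set)\<^esub> \<noteq> \<one>\<^bsub>ring_on (UNIV :: 'a set)\<^esub>" by simp
  fix a :: 'a assume "a \<noteq> \<zero>\<^bsub>ring_on UNIV\<^esub>"
  then show "\<exists>b\<in>carrier (ring_on UNIV). a \<otimes>\<^bsub>ring_on UNIV\<^esub> b = \<one>\<^bsub>ring_on UNIV\<^esub>"
    by (intro bexI[of _ "inverse a"]) auto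
qed

lemma ring_on_uminus: "\<ominus>\<^bsub>ring_on (UNIV :: 'a::field set)\<^esub> x = - x"
proof -
  interpret field "ring_on (UNIV :: 'a set)" by (rule ring_on_UNIV_field)
  show ?thesis using minus_equality[of "- x" x] by simp
qed

lemma ring_on_inv: "x \<noteq> 0 \<Longrightarrow> inv\<^bsub>ring_on (UNIV :: 'a::field set)\<^esub> x = inverse x"
proof -
  interpret field "ring_on (UNIV :: 'a set)" by (rule ring_on_UNIV_field)
  assume "x \<noteq> 0"
  then show ?thesis using inv_unique'[of x "inverse x"] by simp
qed

lemma subfield_ring_on_iff:
  "subfield K (ring_on (UNIV :: 'a::field set)) \<longleftrightarrow>
     1 \<in> K \<and> (\<forall>a\<in>K. \<forall>b\<in>K. a - b \<in> K \<and> a * b \<in> K) \<and> (\<forall>a\<in>K. inverse a \<in> K)"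
proof -
  interpret field "ring_on (UNIV :: 'a set)" by (rule ring_on_UNIV_field)
  show ?thesis
  proof
    assume K: "subfield K (ring_on (UNIV :: 'a set))"
    note R = subringE[OF subfieldE(1)[OF K]]
    have 1: "inverse a \<in> K" if "a \<in> K" for a
    proof (cases "a = 0")
      case False
      then show ?thesis using subfield_m_inv(1)[OF K, of a] that by (simp add: ring_on_inv)
    qed (use R in auto)
    have 2: "a - b \<in> K" if "a \<in> K" "b \<in> K" for a b
      using R(7)[OF that(1) R(5)[OF that(2)]] by (simp add: ring_on_uminus)
    show "1 \<in> K \<and> (\<forall>a\<in>K. \<forall>b\<in>K. a - b \<in> K \<and> a * b \<in> K) \<and> (\<forall>a\<in>K. inverse a \<in> K)"
      using R 1 2 by auto
  next
    assume K: "1 \<in> K \<and> (\<forall>a\<in>K. \<forall>b\<in>K. a - b \<in> K \<and> a * b \<in> K) \<and> (\<forall>a\<in>K. inverse a \<in> K)"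
    then have 0: "0 \<in> K" by (metis cancel_comm_monoid_add_class.diff_cancel)
    then have m: "- a \<in> K" if "a \<in> K" for a using K that by (metis diff_0)
    have p: "a + b \<in> K" if "a \<in> K" "b \<in> K" for a b
      using K that m by (metis diff_minus_eq_add)
    show "subfield K (ring_on (UNIV :: 'a set))"
    proof (rule subfieldI')
      show "subring K (ring_on UNIV)"
        by (rule subringI) (use K 0 m p in \<open>auto simp: ring_on_uminus\<close>)
      show "inv\<^bsub>ring_on UNIV\<^esub> k \<in> K" if "k \<in> K - {\<zero>\<^bsub>ring_on UNIV\<^esub>}" for k
        using K that by (auto simp: ring_on_inv)
    qed
  qed
qed

text \<open>
  In the algebra library polynomials are lists with the leading coefficient first. Reversing the
  list translates them to and from the polynomials used here.
\<close>

lemma algebraic_ring_on_iff: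
  assumes "subfield F (ring_on (UNIV :: 'a::field set))"
  shows "ring.algebraic (ring_on UNIV) F x \<longleftrightarrow> algebraic_over F x"
proof -
  interpret L: field "ring_on (UNIV :: 'a set)" by (rule ring_on_UNIV_field)
  have 0: "0 \<in> F" using subringE(2)[OF subfieldE(1)[OF assms]] by simp
  have pow: "y [^]\<^bsub>ring_on UNIV\<^esub> n = y ^ n" for y :: 'a and n :: nat
    by (induction n) auto
  have eval: "L.eval p x = poly (Poly (rev p)) x" for p
    by (induction p) (auto simp: pow Poly_snoc poly_monom)
  show ?thesis
  proof
    assume "L.algebraic F x"
    then obtain p where p: "p \<in> carrier (F[X]\<^bsub>ring_on UNIV\<^esub>)" "p \<noteq> []" "L.eval p x = 0"
      using L.algebraicE[OF subfieldE(1)[OF assms], of x] by (auto simp: over_def)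
    then have P: "set p \<subseteq> F" "hd p \<noteq> 0"
      by (auto simp: univ_poly_carrier[symmetric] polynomial_def)
    show "algebraic_over F x"
      unfolding algebraic_over_def
    proof (intro exI conjI)
      show "poly (Poly (rev p)) x = 0" using p(3) eval by simp
      show "poly_over F (Poly (rev p))"
        using P(1) 0 by (auto simp: poly_over_def nth_default_def)
          (metis in_mono length_rev nth_mem set_rev)
      have "Polynomial.coeff (Poly (rev p)) (length p - 1) = hd p"
        using p(2) by (simp add: nth_default_def rev_nth hd_conv_nth)
      then show "Poly (rev p) \<noteq> 0" using P(2) by (metis coeff_0)
    qed
  next
    assume "algebraic_over F x"
    then obtain p where p: "p \<noteq> 0" "poly_over F p" "poly p x = 0"
      by (auto simp: algebraic_over_def)
    let ?q = "rev (coeffs p)"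
    have ne: "?q \<noteq> []" using p(1) by simp
    have "hd ?q \<noteq> 0" using p(1) by (simp add: hd_rev last_coeffs_eq_coeff_degree)
    moreover have "set ?q \<subseteq> F" using p(2) 
      by (auto simp: poly_over_def coeffs_def)
    ultimately have "?q \<in> carrier (F[X]\<^bsub>ring_on UNIV\<^esub>)"
      by (simp add: univ_poly_carrier[symmetric] polynomial_def)
    moreover have "L.eval ?q x = 0" using p(3) by (simp add: eval)
    ultimately show "L.algebraic F x" using L.algebraicI[of ?q F x] ne by (simp add: over_def)
  qed
qed

text \<open>
  The coefficients of a polynomial over \<open>E\<close> generate a finite extension \<open>G\<close> of \<open>F\<close>. Adjoining a
  root gives a finite extension of \<open>G\<close>, hence of \<open>F\<close>, and elements of finite extensions are algebraic.
\<close>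

lemma algebraic_over_trans:
  assumes F: "subfield F (ring_on (UNIV :: 'a::field set))"
    and E: "\<And>y. y \<in> E \<Longrightarrow> algebraic_over F y" and x: "algebraic_over E x"
  shows "algebraic_over F x"
proof -
  interpret L: field "ring_on (UNIV :: 'a set)" by (rule ring_on_UNIV_field)
  from x obtain p where p: "p \<noteq> 0" "poly_over E p" "poly p x = 0"
    by (auto simp: algebraic_over_def)
  let ?cs = "coeffs p"
  have cs: "set ?cs \<subseteq> UNIV" "\<And>c. c \<in> set ?cs \<Longrightarrow> (L.algebraic over F) c"
    using E p(2) by (auto simp: over_def algebraic_ring_on_iff[OF F] poly_over_def coeffs_def split: if_splits)
  define G where "G = L.finite_extension F ?cs"
  have G: "subfield G (ring_on UNIV)"
    unfolding G_def using cs by (intro L.finite_extension_is_subfield[OF F]) auto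
  have fG: "L.finite_dimension F G"
    unfolding G_def using cs by (intro L.finite_extension_finite_dimension(1)[OF F]) auto
  have mem: "set ?cs \<subseteq> G"
    using L.finite_extension_mem[OF subfieldE(1)[OF F], of ?cs] unfolding G_def by auto
  have 0: "0 \<in> G" using subringE(2)[OF subfieldE(1)[OF G]] by simp
  have "poly_over G p"
    unfolding poly_over_def
  proof
    fix i show "Polynomial.coeff p i \<in> G"
    proof (cases "i \<le> Polynomial.degree p")
      case True
      then show ?thesis using mem p(1) by (auto simp: coeffs_def subset_iff simp del: upt_Suc)
    next
      case False
      then show ?thesis using 0 by (simp add: coeff_eq_0)
    qed
  qed
  then have "algebraic_over G x" using p by (auto simp: algebraic_over_def)
  then have alg: "(L.algebraic over G) x" by (simp add: over_def algebraic_ring_on_iff[OF G])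
  have fd: "L.finite_dimension G (L.simple_extension G x)"
    using L.finite_dimension_simple_extension[OF G, of x] alg by simp
  have "L.finite_dimension F (L.simple_extension G x)"
    using L.telescopic_base_dim(1)[OF F G fG fd] .
  moreover have "subring (L.simple_extension G x) (ring_on UNIV)"
    using L.simple_extension_is_subring[OF subfieldE(1)[OF G]] by simp
  moreover have "x \<in> L.simple_extension G x"
    using L.simple_extension_mem[OF subfieldE(1)[OF G]] by simp
  ultimately have "(L.algebraic over F) x"
    using L.finite_dimension_imp_algebraic[OF F] by blast
  then show ?thesis by (simp add: over_def algebraic_ring_on_iff[OF F])
qed

definition fractions :: "'a::field set \<Rightarrow> 'a set" where
  "fractions R = {a / b | a b. a \<in> R \<and> b \<in> R \<and> b \<noteq> 0}"

lemma fractions_memI: "a \<in> R \<Longrightarrow> b \<in> R \<Longrightarrow> b \<noteq> 0 \<Longrightarrow> a / b \<in> fractions R"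
  by (auto simp: fractions_def)

lemma subfield_fractions: "subfield (fractions (ring_gen A)) (ring_on UNIV)"
  unfolding subfield_ring_on_iff
proof (intro conjI ballI)
  show "1 \<in> fractions (ring_gen A)"
    using fractions_memI[OF ring_gen.one ring_gen.one, of A] by simp
next
  fix x y assume "x \<in> fractions (ring_gen A)" "y \<in> fractions (ring_gen A)"
  then obtain a b c d where ab: "x = a / b" "a \<in> ring_gen A" "b \<in> ring_gen A" "b \<noteq> 0"
    and cd: "y = c / d" "c \<in> ring_gen A" "d \<in> ring_gen A" "d \<noteq> 0"
    by (auto simp: fractions_def)
  have "x - y = (a * d - c * b) / (b * d)" using ab cd by (simp add: diff_frac_eq)
  then show "x - y \<in> fractions (ring_gen A)"
    using ab cd by (auto intro!: fractions_memI ring_gen.diff ring_gen.mult)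
  have "x * y = (a * c) / (b * d)" using ab cd by simp
  then show "x * y \<in> fractions (ring_gen A)"
    using ab cd by (auto simp del: times_divide_times_eq intro!: fractions_memI ring_gen.mult)
next
  fix x assume "x \<in> fractions (ring_gen A)"
  then obtain a b where ab: "x = a / b" "a \<in> ring_gen A" "b \<in> ring_gen A" "b \<noteq> 0"
    by (auto simp: fractions_def)
  show "inverse x \<in> fractions (ring_gen A)"
  proof (cases "a = 0")
    case True
    then show ?thesis using ab fractions_memI[OF ring_gen_zero ring_gen.one, of A] by simp
  next
    case False
    then show ?thesis using ab fractions_memI[of b _ a] by simp
  qed
qed

lemma ring_gen_subset_fractions: "ring_gen A \<subseteq> fractions (ring_gen A)"
  using fractions_memI[OF _ ring_gen.one, of _ A] by fastforce

lemma clear_denominators: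
  assumes "poly_over (fractions (ring_gen A)) p"
  shows "\<exists>d. d \<noteq> 0 \<and> d \<in> ring_gen A \<and> poly_over (ring_gen A) (Polynomial.smult d p)"
  using assms
proof (induction p)
  case 0
  then show ?case by (intro exI[of _ 1]) (auto simp: poly_over_def ring_gen.one ring_gen_zero)
next
  case (pCons x p)
  have 0: "0 \<in> fractions (ring_gen A)" using ring_gen_subset_fractions ring_gen_zero by blast
  obtain d where d: "d \<noteq> 0" "d \<in> ring_gen A" "poly_over (ring_gen A) (Polynomial.smult d p)"
    using pCons 0 by (auto simp: poly_over_pCons)
  obtain a b where ab: "x = a / b" "a \<in> ring_gen A" "b \<in> ring_gen A" "b \<noteq> 0"
    using pCons.prems 0 by (auto simp: poly_over_pCons fractions_def)
  have 1: "b * d * x = d * a" using ab by simp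
  have "poly_over (ring_gen A) (Polynomial.smult (b * d) p)"
    using d(3) ab by (auto simp: poly_over_def mult.assoc intro: ring_gen.mult)
  then have "poly_over (ring_gen A) (Polynomial.smult (b * d) (pCons x p))"
    using ab d by (auto simp: poly_over_pCons ring_gen_zero 1 intro: ring_gen.mult)
  then show ?case using ab d by (intro exI[of _ "b * d"]) (auto intro: ring_gen.mult)
qed

lemma acl_eq_algebraic_over_fractions: "acl A = {x. algebraic_over (fractions (ring_gen A)) x}"
proof (intro equalityI subsetI; clarsimp simp: acl_def)
  fix x assume "algebraic_over (ring_gen A) x"
  then show "algebraic_over (fractions (ring_gen A)) x"
    using algebraic_over_mono ring_gen_subset_fractions by blast
next
  fix x assume "algebraic_over (fractions (ring_gen A)) x"
  then obtain p where p: "p \<noteq> 0" "poly_over (fractions (ring_gen A)) p" "poly p x = 0"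
    by (auto simp: algebraic_over_def)
  then obtain d where "d \<noteq> 0" "d \<in> ring_gen A" "poly_over (ring_gen A) (Polynomial.smult d p)"
    using clear_denominators by blast
  then show "algebraic_over (ring_gen A) x"
    using p unfolding algebraic_over_def by (intro exI[of _ "Polynomial.smult d p"]) auto
qed

lemma subfield_acl: "subfield (acl A) (ring_on UNIV)"
proof -
  interpret L: field "ring_on (UNIV :: 'a set)" by (rule ring_on_UNIV_field)
  show ?thesis
    using L.subfield_of_algebraics[OF subfield_fractions[of A]]
    by (simp add: over_def algebraic_ring_on_iff[OF subfield_fractions] acl_eq_algebraic_over_fractions)
qed

lemma ring_gen_subfield:
  assumes "subfield K (ring_on (UNIV :: 'a::field set))"
  shows "ring_gen K = K"
  using ring_gen_least[of K K] assms unfolding subfield_ring_on_iff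
  by (auto intro: ring_gen.base)

lemma acl_mono: "A \<subseteq> B \<Longrightarrow> acl A \<subseteq> acl B"
  unfolding acl_def using algebraic_over_mono[OF ring_gen_mono] by blast

lemma algebraic_over_self: "0 \<in> R \<Longrightarrow> 1 \<in> R \<Longrightarrow> - x \<in> R \<Longrightarrow> algebraic_over R x"
  unfolding algebraic_over_def
  by (intro exI[of _ "[:- x, 1:]"]) (simp add: poly_over_pCons, simp add: poly_over_def)

lemma acl_superset: "A \<subseteq> acl A"
  unfolding acl_def
  by (auto intro!: algebraic_over_self ring_gen_zero ring_gen.one ring_gen_uminus intro: ring_gen.base)

lemma acl_idem: "acl (acl A) = acl A"
proof
  show "acl (acl A) \<subseteq> acl A"
  proof
    fix x assume "x \<in> acl (acl A)"
    then have "algebraic_over (acl A) x"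
      using ring_gen_subfield[OF subfield_acl[of A]] by (simp add: acl_def)
    then have "algebraic_over (fractions (ring_gen A)) x"
      using algebraic_over_trans[OF subfield_fractions, of "acl A"]
      by (auto simp: acl_eq_algebraic_over_fractions)
    then show "x \<in> acl A" by (simp add: acl_eq_algebraic_over_fractions)
  qed
qed (rule acl_superset)

lemma acl_finite_subset: "x \<in> acl A \<Longrightarrow> \<exists>F. finite F \<and> F \<subseteq> A \<and> x \<in> acl F"
proof -
  assume "x \<in> acl A"
  then obtain p where p: "p \<noteq> 0" "poly_over (ring_gen A) p" "poly p x = 0"
    unfolding acl_def algebraic_over_def by blast
  obtain F where "finite F" "F \<subseteq> A" "poly_over (ring_gen F) p"
    using poly_over_finite_subset[OF p(2)] by blast
  then show ?thesis using p(1,3) unfolding acl_def algebraic_over_def by blast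
qed

text \<open>
  An algebraic relation for \<open>x\<close> over \<open>A\<close> and \<open>y\<close> is a polynomial relation between \<open>x\<close> and \<open>y\<close>.
  Read as a relation for \<open>y\<close>, it can only be trivial if all its coefficients, which are
  polynomials in \<open>x\<close>, vanish; then \<open>x\<close> itself would be algebraic over \<open>A\<close>.
\<close>

lemma acl_exchange:
  fixes x y :: "'a::field"
  assumes x: "x \<in> acl (insert y A)" "x \<notin> acl A"
  shows "y \<in> acl (insert x A)"
proof -
  let ?R = "ring_gen A"
  from x(1) obtain p where p: "p \<noteq> 0" "poly_over (ring_gen (insert y A)) p" "poly p x = 0"
    unfolding acl_def algebraic_over_def by blast
  have "\<exists>q. poly_over ?R q \<and> poly q y = Polynomial.coeff p i" for i
  proof -
    have "Polynomial.coeff p i \<in> ring_gen (insert y A)" using p(2) by (simp add: poly_over_def)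
    then show ?thesis unfolding ring_gen_insert by auto
  qed
  then obtain q where q: "\<And>i. poly_over ?R (q i)" "\<And>i. poly (q i) y = Polynomial.coeff p i"
    by metis
  define n where "n = Polynomial.degree p"
  define d where "d = Max ((\<lambda>i. Polynomial.degree (q i)) ` {..n})"
  have d: "Polynomial.degree (q i) \<le> d" if "i \<le> n" for i
    unfolding d_def using that by (intro Max_ge) auto
  \<comment> \<open>The same double sum, read as a polynomial in \<open>y\<close> with coefficients \<open>poly (r j) x\<close>.\<close>
  define r where "r j = (\<Sum>i\<le>n. Polynomial.monom (Polynomial.coeff (q i) j) i)" for j
  have cr: "Polynomial.coeff (r j) i = (if i \<le> n then Polynomial.coeff (q i) j else 0)" for i j
    by (simp add: r_def coeff_sum)
  have r: "poly_over ?R (r j)" for j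
    using q(1) by (auto simp: poly_over_def cr ring_gen_zero)
  define Q where "Q = (\<Sum>j\<le>d. Polynomial.monom (poly (r j) x) j)"
  have cQ: "Polynomial.coeff Q j = (if j \<le> d then poly (r j) x else 0)" for j
    by (simp add: Q_def coeff_sum)
  have "poly Q y = (\<Sum>j\<le>d. poly (r j) x * y ^ j)"
    by (simp add: Q_def poly_sum poly_monom)
  also have "\<dots> = (\<Sum>j\<le>d. \<Sum>i\<le>n. Polynomial.coeff (q i) j * x ^ i * y ^ j)"
    by (simp add: r_def poly_sum poly_monom sum_distrib_right)
  also have "\<dots> = (\<Sum>i\<le>n. \<Sum>j\<le>d. Polynomial.coeff (q i) j * x ^ i * y ^ j)"
    by (rule sum.swap)
  also have "\<dots> = (\<Sum>i\<le>n. (\<Sum>j\<le>d. Polynomial.coeff (q i) j * y ^ j) * x ^ i)"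
    by (simp add: sum_distrib_left sum_distrib_right mult_ac)
  also have "\<dots> = (\<Sum>i\<le>n. poly (q i) y * x ^ i)"
  proof (rule sum.cong[OF refl])
    fix i assume "i \<in> {..n}"
    then have "(\<Sum>j\<le>d. Polynomial.coeff (q i) j * y ^ j) = poly (q i) y"
      unfolding poly_altdef using d[of i] by (intro sum.mono_neutral_right) (auto simp: coeff_eq_0)
    then show "(\<Sum>j\<le>d. Polynomial.coeff (q i) j * y ^ j) * x ^ i = poly (q i) y * x ^ i" by (simp only:)
  qed
  also have "\<dots> = poly p x" by (simp add: q(2) n_def poly_altdef[of p])
  finally have Q0: "poly Q y = 0" using p(3) by simp
  have "poly (r j) x \<in> ring_gen (insert x A)" for j
    unfolding ring_gen_insert using r by blast
  then have Qo: "poly_over (ring_gen (insert x A)) Q"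
    by (simp add: poly_over_def cQ ring_gen_zero)
  have "Q \<noteq> 0"
  proof
    assume "Q = 0"
    then have zero: "poly (r j) x = 0" if "j \<le> d" for j using cQ[of j] that by simp
    have r0: "r j = 0" if "j \<le> d" for j
    proof (rule ccontr)
      assume "r j \<noteq> 0"
      then have "x \<in> acl A" using r[of j] zero[OF that] unfolding acl_def algebraic_over_def by blast
      then show False using x(2) by blast
    qed
    have "Polynomial.coeff (q n) j = 0" for j
    proof (cases "j \<le> d")
      case True
      then show ?thesis using r0[OF True] cr[of j n] by simp
    next
      case False
      then show ?thesis using d[of n] by (simp add: coeff_eq_0)
    qed
    then have "q n = 0" by (simp add: poly_eq_iff)
    then show False using q(2)[of n] p(1) by (simp add: n_def)
  qed
  then show ?thesis using Q0 Qo unfolding acl_def algebraic_over_def by blast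
qed

section \<open>Pregeometries\<close>

text \<open>
  Closure operators with the exchange property, such as linear span and algebraic closure.
\<close>

locale pregeometry =
  fixes cl :: "'a set \<Rightarrow> 'a set"
  assumes cl_superset: "A \<subseteq> cl A"
    and cl_mono: "A \<subseteq> B \<Longrightarrow> cl A \<subseteq> cl B"
    and cl_idem: "cl (cl A) = cl A"
    and cl_finite_subset: "x \<in> cl A \<Longrightarrow> \<exists>F. finite F \<and> F \<subseteq> A \<and> x \<in> cl F"
    and cl_exchange: "x \<in> cl (insert y A) \<Longrightarrow> x \<notin> cl A \<Longrightarrow> y \<in> cl (insert x A)"
begin

lemma cl_least: "A \<subseteq> cl B \<Longrightarrow> cl A \<subseteq> cl B"
  using cl_mono[of A "cl B"] cl_idem[of B] by simp

lemma cl_memI: "x \<in> A \<Longrightarrow> x \<in> cl A"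
  using cl_superset by blast

lemma cl_monoD: "x \<in> cl A \<Longrightarrow> A \<subseteq> B \<Longrightarrow> x \<in> cl B"
  using cl_mono by blast

definition independent_over :: "'a set \<Rightarrow> 'a set \<Rightarrow> bool" where
  "independent_over A Y \<longleftrightarrow> (\<forall>y\<in>Y. y \<notin> cl (A \<union> (Y - {y})))"

lemma independent_over_subset:
  assumes "independent_over A Y" "Z \<subseteq> Y" "B \<subseteq> A"
  shows "independent_over B Z"
  unfolding independent_over_def
proof
  fix z assume z: "z \<in> Z"
  have "B \<union> (Z - {z}) \<subseteq> A \<union> (Y - {z})" using assms by blast
  then show "z \<notin> cl (B \<union> (Z - {z}))"
    using assms z cl_monoD unfolding independent_over_def by blast
qed

text \<open>
  Take \<open>K\<close> maximal among the supersets of \<open>A\<close> over which \<open>Y\<close> is independent; unions of chains are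
  admissible because \<open>cl\<close> is finitary. An element outside \<open>cl (K \<union> Y)\<close> could be added to \<open>K\<close> by
  the exchange property, and \<open>cl K\<close> is also admissible.
\<close>

lemma exists_spanning_complement:
  assumes Y: "independent_over A Y"
  shows "\<exists>K. A \<subseteq> K \<and> cl K = K \<and> independent_over K Y \<and> cl (K \<union> Y) = UNIV"
proof -
  let ?P = "{K. A \<subseteq> K \<and> independent_over K Y}"
  have "\<exists>K\<in>?P. \<forall>K'\<in>?P. K \<subseteq> K' \<longrightarrow> K' = K"
  proof (rule subset_Zorn_nonempty)
    show "?P \<noteq> {}" using Y by blast
  next
    fix C assume C: "C \<noteq> {}" "subset.chain ?P C"
    have "independent_over (\<Union>C) Y"
      unfolding independent_over_def
    proof (intro ballI notI)
      fix y assume y: "y \<in> Y" "y \<in> cl (\<Union>C \<union> (Y - {y}))"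
      obtain F where F: "finite F" "F \<subseteq> \<Union>C \<union> (Y - {y})" "y \<in> cl F"
        using cl_finite_subset[OF y(2)] by blast
      have "finite (F - (Y - {y}))" "F - (Y - {y}) \<subseteq> \<Union>C" using F by auto
      then obtain K where K: "K \<in> C" "F - (Y - {y}) \<subseteq> K"
        using finite_subset_Union_chain[of _ C ?P] C by blast
      have "F \<subseteq> K \<union> (Y - {y})" using K by blast
      then have "y \<in> cl (K \<union> (Y - {y}))" using cl_monoD F by blast
      moreover have "independent_over K Y" using K C by (auto simp: subset_chain_def)
      ultimately show False using y(1) unfolding independent_over_def by blast
    qed
    moreover have "A \<subseteq> \<Union>C"
    proof -
      obtain K where "K \<in> C" using C(1) by blast
      then show ?thesis using C(2) by (auto simp: subset_chain_def)
    qed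
    ultimately show "\<Union>C \<in> ?P" by blast
  qed
  then obtain K where K_max: "K \<in> ?P" "\<forall>K'\<in>?P. K \<subseteq> K' \<longrightarrow> K' = K"
    by (elim bexE)
  from K_max(1) have K: "A \<subseteq> K" "independent_over K Y" by simp_all
  have max: "K' = K" if "A \<subseteq> K'" "independent_over K' Y" "K \<subseteq> K'" for K'
    by (rule mp[OF bspec[OF K_max(2)] that(3)]) (use that in simp)
  have "independent_over (cl K) Y"
    unfolding independent_over_def
  proof (intro ballI notI)
    fix y assume y: "y \<in> Y" "y \<in> cl (cl K \<union> (Y - {y}))"
    have "cl K \<union> (Y - {y}) \<subseteq> cl (K \<union> (Y - {y}))"
      using cl_mono[of K "K \<union> (Y - {y})"] cl_superset[of "K \<union> (Y - {y})"] by blast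
    from cl_least[OF this] have "y \<in> cl (K \<union> (Y - {y}))" using y(2) by blast
    then show False using K(2) y(1) unfolding independent_over_def by blast
  qed
  then have flat: "cl K = K" using max[of "cl K"] K(1) cl_superset[of K] by blast
  have "x \<in> cl (K \<union> Y)" for x
  proof (rule ccontr)
    assume x: "x \<notin> cl (K \<union> Y)"
    have "independent_over (insert x K) Y"
      unfolding independent_over_def
    proof (intro ballI notI)
      fix y assume y: "y \<in> Y" "y \<in> cl (insert x K \<union> (Y - {y}))"
      then have "y \<in> cl (insert x (K \<union> (Y - {y})))" by simp
      moreover have "y \<notin> cl (K \<union> (Y - {y}))"
        using K(2) y(1) unfolding independent_over_def by blast
      ultimately have "x \<in> cl (insert y (K \<union> (Y - {y})))" by (rule cl_exchange)
      moreover have "insert y (K \<union> (Y - {y})) = K \<union> Y" using y(1) by blast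
      ultimately show False using x by simp
    qed
    then have "insert x K = K" using max[of "insert x K"] K(1) by blast
    then show False using x cl_memI[of x "K \<union> Y"] by blast
  qed
  then show ?thesis using K flat by blast
qed

text \<open>
  Adding the elements of \<open>D\<close> one at a time, some first \<open>y\<close> brings \<open>x\<close> into the closure. This
  prepares the exchange of \<open>x\<close> for \<open>y\<close>.
\<close>

lemma steinitz_step:
  assumes "finite D" "x \<in> cl (C \<union> D)" "x \<notin> cl C"
  shows "\<exists>Z y. Z \<subseteq> D \<and> y \<in> D \<and> y \<notin> Z \<and> x \<notin> cl (C \<union> Z) \<and> x \<in> cl (insert y (C \<union> Z))"
  using assms
proof (induction D)
  case empty
  then show ?case by simp
next
  case (insert d D)
  show ?case
  proof (cases "x \<in> cl (C \<union> D)")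
    case True
    then show ?thesis using insert.IH insert.prems by blast
  next
    case False
    then show ?thesis using insert by (intro exI[of _ D] exI[of _ d]) auto
  qed
qed

text \<open>
  The Steinitz exchange argument: elements of \<open>Y\<close> are replaced by elements of \<open>B\<close>, keeping the
  cardinality and the closure large enough, until \<open>B\<close> is contained in \<open>Y\<close>. The exchanged element
  \<open>y\<close> has to be chosen outside \<open>B\<close>, so that \<open>B - Y\<close> shrinks.
\<close>

lemma steinitz:
  assumes "finite B" "independent_over A B" "finite Y" "B \<subseteq> cl (A \<union> Y)"
  shows "card B \<le> card Y"
  using assms(3,4)
proof (induction "card (B - Y)" arbitrary: Y rule: less_induct)
  case less
  show ?case
  proof (cases "B \<subseteq> Y")
    case True
    then show ?thesis using less by (simp add: card_mono)
  next
    case False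
    then obtain b where b: "b \<in> B" "b \<notin> Y" by blast
    have "A \<union> (Y \<inter> B) \<union> (Y - B) = A \<union> Y" by blast
    then have 1: "b \<in> cl (A \<union> (Y \<inter> B) \<union> (Y - B))" using b less.prems by auto
    have "A \<union> (Y \<inter> B) \<subseteq> A \<union> (B - {b})" using b by blast
    then have 2: "b \<notin> cl (A \<union> (Y \<inter> B))"
      using b(1) assms(2) cl_monoD unfolding independent_over_def by blast
    obtain Z y where Z: "Z \<subseteq> Y - B" "y \<in> Y - B" "y \<notin> Z" "b \<notin> cl (A \<union> (Y \<inter> B) \<union> Z)"
      "b \<in> cl (insert y (A \<union> (Y \<inter> B) \<union> Z))"
      using steinitz_step[OF _ 1 2] less.prems(1) by blast
    define Y' where "Y' = insert b (Y - {y})"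
    have "y \<in> cl (insert b (A \<union> (Y \<inter> B) \<union> Z))" using cl_exchange[OF Z(5,4)] .
    moreover have "insert b (A \<union> (Y \<inter> B) \<union> Z) \<subseteq> A \<union> Y'" using Z unfolding Y'_def by blast
    ultimately have y: "y \<in> cl (A \<union> Y')" using cl_monoD by blast
    have "A \<union> Y \<subseteq> insert y (A \<union> Y')" unfolding Y'_def by blast
    also have "\<dots> \<subseteq> cl (A \<union> Y')" using y cl_superset[of "A \<union> Y'"] by blast
    finally have "cl (A \<union> Y) \<subseteq> cl (A \<union> Y')" by (rule cl_least)
    then have B: "B \<subseteq> cl (A \<union> Y')" using less.prems by blast
    have card: "card Y' = card Y"
      unfolding Y'_def using b Z(2) less.prems(1) card.remove[of Y y] by simp
    have "B - Y' \<subset> B - Y" unfolding Y'_def using b Z(2) by blast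
    then have "card (B - Y') < card (B - Y)" using assms(1) by (intro psubset_card_mono) auto
    then show ?thesis
      using less.hyps[of Y'] B card less.prems(1) unfolding Y'_def by simp
  qed
qed

end

interpretation acl: pregeometry "acl :: 'a::field set \<Rightarrow> 'a set"
  by unfold_locales (fact acl_superset acl_mono acl_idem acl_finite_subset acl_exchange)+

section \<open>Transcendence degree\<close>

definition monomial_eval :: "('a \<Rightarrow>\<^sub>0 nat) \<Rightarrow> 'a::comm_ring_1" where
  "monomial_eval m = (\<Prod>b\<in>Poly_Mapping.keys m. b ^ Poly_Mapping.lookup m b)"

definition mpoly_over :: "'a set \<Rightarrow> 'a set \<Rightarrow> (('a \<Rightarrow>\<^sub>0 nat) \<Rightarrow>\<^sub>0 'a::comm_ring_1) \<Rightarrow> bool" where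
  "mpoly_over K A q \<longleftrightarrow> (\<forall>m. Poly_Mapping.lookup q m \<in> K) \<and>
     (\<forall>m\<in>Poly_Mapping.keys q. Poly_Mapping.keys m \<subseteq> A)"

lemma algebraically_independent_iff:
  "algebraically_independent K B \<longleftrightarrow> (\<forall>q. mpoly_over K B q \<longrightarrow> mpoly_eval q = 0 \<longrightarrow> q = 0)"
  by (auto simp: algebraically_independent_def mpoly_over_def)

lemma monomial_eval_superset:
  assumes "finite F" "Poly_Mapping.keys m \<subseteq> F"
  shows "monomial_eval m = (\<Prod>b\<in>F. b ^ Poly_Mapping.lookup m b)"
  unfolding monomial_eval_def using assms
  by (intro prod.mono_neutral_left) (auto simp: in_keys_iff)

lemma monomial_eval_add: "monomial_eval (m + n) = monomial_eval m * monomial_eval n"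
proof -
  let ?F = "Poly_Mapping.keys m \<union> Poly_Mapping.keys n"
  have "monomial_eval (m + n) = (\<Prod>b\<in>?F. b ^ Poly_Mapping.lookup (m + n) b)"
    by (rule monomial_eval_superset) (auto dest: set_mp[OF Poly_Mapping.keys_add])
  also have "\<dots> = (\<Prod>b\<in>?F. b ^ Poly_Mapping.lookup m b) * (\<Prod>b\<in>?F. b ^ Poly_Mapping.lookup n b)"
    by (simp add: lookup_add power_add prod.distrib)
  also have "\<dots> = monomial_eval m * monomial_eval n"
    using monomial_eval_superset[of ?F m] monomial_eval_superset[of ?F n] by simp
  finally show ?thesis .
qed

lemma monomial_eval_single: "monomial_eval (Poly_Mapping.single b i) = b ^ i"
  by (simp add: monomial_eval_def)

lemma mpoly_eval_superset:
  assumes "finite F" "Poly_Mapping.keys q \<subseteq> F"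
  shows "mpoly_eval q = (\<Sum>m\<in>F. Poly_Mapping.lookup q m * monomial_eval m)"
  unfolding mpoly_eval_def monomial_eval_def[symmetric] using assms
  by (intro sum.mono_neutral_left) (auto simp: in_keys_iff)

lemma mpoly_eval_add: "mpoly_eval (p + q) = mpoly_eval p + mpoly_eval q"
proof -
  let ?F = "Poly_Mapping.keys p \<union> Poly_Mapping.keys q"
  have "mpoly_eval (p + q) = (\<Sum>m\<in>?F. Poly_Mapping.lookup (p + q) m * monomial_eval m)"
    by (rule mpoly_eval_superset) (auto dest: set_mp[OF Poly_Mapping.keys_add])
  also have "\<dots> = (\<Sum>m\<in>?F. Poly_Mapping.lookup p m * monomial_eval m) + (\<Sum>m\<in>?F. Poly_Mapping.lookup q m * monomial_eval m)"
    by (simp add: lookup_add distrib_right sum.distrib)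
  also have "\<dots> = mpoly_eval p + mpoly_eval q"
    using mpoly_eval_superset[of ?F p] mpoly_eval_superset[of ?F q] by simp
  finally show ?thesis .
qed

lemma mpoly_eval_zero [simp]: "mpoly_eval 0 = 0"
  by (simp add: mpoly_eval_def)

lemma mpoly_eval_sum: "mpoly_eval (sum f I) = (\<Sum>i\<in>I. mpoly_eval (f i))"
  by (induction I rule: infinite_finite_induct) (simp_all add: mpoly_eval_add)

lemma mpoly_eval_single: "mpoly_eval (Poly_Mapping.single m c) = c * monomial_eval m"
  by (simp add: mpoly_eval_def monomial_eval_def)

context
  fixes K :: "'a::field set"
  assumes K: "subfield K (ring_on UNIV)"
begin

lemma subfield_on_zero: "0 \<in> K" and subfield_on_one: "1 \<in> K" 
  and subfield_on_diff: "a \<in> K \<Longrightarrow> b \<in> K \<Longrightarrow> a - b \<in> K"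
  and subfield_on_add: "a \<in> K \<Longrightarrow> b \<in> K \<Longrightarrow> a + b \<in> K"
  and subfield_on_mult: "a \<in> K \<Longrightarrow> b \<in> K \<Longrightarrow> a * b \<in> K"
  using ring_gen_zero[of K] ring_gen.one[of K] ring_gen.diff[of a K b] ring_gen_add[of a K b]
    ring_gen.mult[of a K b] ring_gen_subfield[OF K] by simp_all

lemma mpoly_over_zero: "mpoly_over K A 0"
  by (simp add: mpoly_over_def subfield_on_zero)

lemma mpoly_over_add: "mpoly_over K A p \<Longrightarrow> mpoly_over K A q \<Longrightarrow> mpoly_over K A (p + q)"
  using Poly_Mapping.keys_add[of p q] unfolding mpoly_over_def lookup_add
  by (blast intro: subfield_on_add)

lemma mpoly_over_sum: "(\<And>i. i \<in> I \<Longrightarrow> mpoly_over K A (f i)) \<Longrightarrow> mpoly_over K A (sum f I)"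
  by (induction I rule: infinite_finite_induct) (auto intro: mpoly_over_zero mpoly_over_add)

lemma mpoly_over_single:
  "c \<in> K \<Longrightarrow> Poly_Mapping.keys m \<subseteq> A \<Longrightarrow> mpoly_over K A (Poly_Mapping.single m c)"
  by (auto simp: mpoly_over_def lookup_single subfield_on_zero when_def)

text \<open>
  Closure of the right hand side under products is checked on values, where a product of two sums is
  a double sum of monomials.
\<close>

lemma ring_gen_eq_mpoly_eval:
  "ring_gen (K \<union> A) = {mpoly_eval q | q. mpoly_over K A q}" (is "_ = ?E")
proof
  have single: "c * monomial_eval m \<in> ?E" if "c \<in> K" "Poly_Mapping.keys m \<subseteq> A" for c m
    using mpoly_over_single[OF that]
    by (intro CollectI exI[of _ "Poly_Mapping.single m c"]) (simp add: mpoly_eval_single)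
  have add: "a + b \<in> ?E" if ab: "a \<in> ?E" "b \<in> ?E" for a b
  proof -
    obtain p q where "mpoly_over K A p" "a = mpoly_eval p" "mpoly_over K A q" "b = mpoly_eval q"
      using ab by blast
    then show ?thesis
      by (intro CollectI exI[of _ "p + q"]) (simp add: mpoly_eval_add mpoly_over_add)
  qed
  have zero: "0 \<in> ?E"
    by (intro CollectI exI[of _ 0]) (simp add: mpoly_over_zero)
  have sum: "sum f I \<in> ?E" if "\<And>i. i \<in> I \<Longrightarrow> f i \<in> ?E" for f and I :: "'i set"
    using that
  proof (induction I rule: infinite_finite_induct)
    case (insert i I)
    have "f i + sum f I \<in> ?E" using insert.prems insert.IH by (intro add) simp_all
    then show ?case using insert.hyps by simp
  qed (use zero in simp_all)
  have mult: "a * b \<in> ?E" if ab: "a \<in> ?E" "b \<in> ?E" for a b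
  proof -
    obtain p q where p: "mpoly_over K A p" "a = mpoly_eval p" and q: "mpoly_over K A q" "b = mpoly_eval q"
      using ab by blast
    have "a * b = (\<Sum>m\<in>Poly_Mapping.keys p. \<Sum>n\<in>Poly_Mapping.keys q.
        (Poly_Mapping.lookup p m * Poly_Mapping.lookup q n) * monomial_eval (m + n))"
      unfolding p(2) q(2) mpoly_eval_superset[OF finite_keys order_refl] sum_product monomial_eval_add
      by (simp add: mult_ac)
    also have "\<dots> \<in> ?E"
    proof (intro sum single)
      fix m n assume "m \<in> Poly_Mapping.keys p" "n \<in> Poly_Mapping.keys q"
      then show "Poly_Mapping.keys (m + n) \<subseteq> A"
        using p(1) q(1) Poly_Mapping.keys_add[of m n] unfolding mpoly_over_def by blast
      show "Poly_Mapping.lookup p m * Poly_Mapping.lookup q n \<in> K"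
        using p(1) q(1) by (auto simp: mpoly_over_def intro: subfield_on_mult)
    qed
    finally show ?thesis .
  qed
  have const: "c \<in> ?E" if "c \<in> K" for c
    using single[OF that, of 0] by (simp add: monomial_eval_def)
  show "ring_gen (K \<union> A) \<subseteq> ?E"
  proof (rule ring_gen_least)
    show "K \<union> A \<subseteq> ?E"
    proof
      fix x assume "x \<in> K \<union> A"
      then show "x \<in> ?E"
        using const[of x] single[of 1 "Poly_Mapping.single x 1"] subfield_on_one by (auto simp: monomial_eval_single)
    qed
    show "1 \<in> ?E" using const subfield_on_one .
    fix a b assume ab: "a \<in> ?E" "b \<in> ?E"
    have "(-1) * b \<in> ?E" using mult[OF const[of "-1"] ab(2)] subfield_on_diff[OF subfield_on_zero subfield_on_one] by simp
    from add[OF ab(1) this] show "a - b \<in> ?E" by simp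
    show "a * b \<in> ?E" using mult ab .
  qed
  show "?E \<subseteq> ring_gen (K \<union> A)"
  proof
    fix x assume "x \<in> ?E"
    then obtain q where q: "mpoly_over K A q" "x = mpoly_eval q" by blast
    have "monomial_eval m \<in> ring_gen (K \<union> A)" if "m \<in> Poly_Mapping.keys q" for m
    proof -
      have "(\<Prod>b\<in>B. b ^ Poly_Mapping.lookup m b) \<in> ring_gen (K \<union> A)" if "B \<subseteq> A" for B
        using that by (induction B rule: infinite_finite_induct)
          (auto intro: ring_gen.one ring_gen.mult ring_gen_power ring_gen.base)
      then show ?thesis using q(1) that by (auto simp: mpoly_over_def monomial_eval_def)
    qed
    then show "x \<in> ring_gen (K \<union> A)"
      unfolding q(2) mpoly_eval_superset[OF finite_keys order_refl]
      using q(1) by (auto simp: mpoly_over_def intro!: ring_gen_sum ring_gen.mult intro: ring_gen.base)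
  qed
qed

text \<open>
  A polynomial in one variable with root \<open>b\<close>, whose coefficients are polynomial expressions in the
  elements of \<open>A\<close>, combines to a polynomial in several variables that vanishes at \<open>A\<close> and \<open>b\<close>. It is
  not zero, since the exponent of \<open>b\<close> recovers the coefficient that a monomial came from.
\<close>

lemma algebraically_independent_imp_notin_acl:
  assumes b: "b \<notin> A" and ind: "algebraically_independent K (insert b A)"
  shows "b \<notin> acl (K \<union> A)"
proof
  assume "b \<in> acl (K \<union> A)"
  then obtain P where P: "P \<noteq> 0" "poly_over (ring_gen (K \<union> A)) P" "poly P b = 0"
    unfolding acl_def algebraic_over_def by blast
  have "\<exists>q. mpoly_over K A q \<and> Polynomial.coeff P i = mpoly_eval q" for i
  proof -
    have "Polynomial.coeff P i \<in> ring_gen (K \<union> A)" using P(2) by (simp add: poly_over_def)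
    then show ?thesis unfolding ring_gen_eq_mpoly_eval by auto
  qed
  then obtain Q where Q: "\<And>i. mpoly_over K A (Q i)" "\<And>i. Polynomial.coeff P i = mpoly_eval (Q i)"
    by metis
  define n where "n = Polynomial.degree P"
  define q where "q = (\<Sum>i\<le>n. \<Sum>m\<in>Poly_Mapping.keys (Q i).
    Poly_Mapping.single (m + Poly_Mapping.single b i) (Poly_Mapping.lookup (Q i) m))"
  have keys: "Poly_Mapping.keys m \<subseteq> A" if "m \<in> Poly_Mapping.keys (Q i)" for m i
    using Q(1)[of i] that by (simp add: mpoly_over_def)
  have "mpoly_over K (insert b A) q"
    unfolding q_def
  proof (intro mpoly_over_sum mpoly_over_single)
    fix i m assume m: "m \<in> Poly_Mapping.keys (Q i)"
    show "Poly_Mapping.lookup (Q i) m \<in> K" using Q(1)[of i] by (simp add: mpoly_over_def)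
    have "Poly_Mapping.keys (m + Poly_Mapping.single b i) \<subseteq>
        Poly_Mapping.keys m \<union> Poly_Mapping.keys (Poly_Mapping.single b i)"
      by (rule Poly_Mapping.keys_add)
    then show "Poly_Mapping.keys (m + Poly_Mapping.single b i) \<subseteq> insert b A"
      using keys[OF m] by (auto split: if_splits)
  qed
  moreover have "mpoly_eval q = 0"
  proof -
    have "mpoly_eval q = (\<Sum>i\<le>n. (\<Sum>m\<in>Poly_Mapping.keys (Q i). Poly_Mapping.lookup (Q i) m * monomial_eval m) * b ^ i)"
      by (simp add: q_def mpoly_eval_sum mpoly_eval_single monomial_eval_add monomial_eval_single sum_distrib_left
          sum_distrib_right mult_ac)
    also have "\<dots> = (\<Sum>i\<le>n. Polynomial.coeff P i * b ^ i)"
      by (simp add: Q(2) mpoly_eval_superset[OF finite_keys order_refl])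
    also have "\<dots> = poly P b" by (simp add: poly_altdef n_def)
    finally show ?thesis using P(3) by simp
  qed
  ultimately have q0: "q = 0" using ind by (simp add: algebraically_independent_iff)
  have "Q n \<noteq> 0" using Q(2)[of n] P(1) by (auto simp: n_def)
  then obtain m0 where m0: "m0 \<in> Poly_Mapping.keys (Q n)" by (metis ex_in_conv keys_eq_empty)
  have inj: "m + Poly_Mapping.single b i = m0 + Poly_Mapping.single b n \<longleftrightarrow> i = n \<and> m = m0"
    if "m \<in> Poly_Mapping.keys (Q i)" for m i
  proof
    assume eq: "m + Poly_Mapping.single b i = m0 + Poly_Mapping.single b n"
    have "Poly_Mapping.lookup m b = 0" "Poly_Mapping.lookup m0 b = 0"
      using keys[OF that] keys[OF m0] b by (auto simp: in_keys_iff)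
    then have "i = n"
      using arg_cong[OF eq, of "\<lambda>m. Poly_Mapping.lookup m b"] by (simp add: lookup_add)
    then show "i = n \<and> m = m0" using eq by simp
  qed simp
  have "Poly_Mapping.lookup q (m0 + Poly_Mapping.single b n) =
      (\<Sum>i\<le>n. \<Sum>m\<in>Poly_Mapping.keys (Q i). if i = n \<and> m = m0 then Poly_Mapping.lookup (Q i) m else 0)"
    unfolding q_def by (auto simp: lookup_sum lookup_single when_def inj intro!: sum.cong)
  also have "\<dots> = (\<Sum>i\<le>n. if i = n then Poly_Mapping.lookup (Q n) m0 else 0)"
  proof (rule sum.cong[OF refl])
    fix i
    show "(\<Sum>m\<in>Poly_Mapping.keys (Q i). if i = n \<and> m = m0 then Poly_Mapping.lookup (Q i) m else 0) =
      (if i = n then Poly_Mapping.lookup (Q n) m0 else 0)"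
      using m0 by (cases "i = n") auto
  qed
  also have "\<dots> = Poly_Mapping.lookup (Q n) m0" by simp
  finally show False using q0 m0 by (simp add: in_keys_iff)
qed

text \<open>
  Induction on \<open>B\<close>: sort the monomials of a vanishing polynomial by their exponent of the new
  element \<open>b\<close>. As \<open>b\<close> is transcendental over the others, each of the resulting coefficients vanishes,
  and the induction hypothesis applies to them.
\<close>

lemma independent_imp_algebraically_independent:
  assumes "finite B" "acl.independent_over K B"
  shows "algebraically_independent K B"
  using assms
proof (induction B)
  case empty
  have "q = 0" if "mpoly_over K {} q" "mpoly_eval q = 0" for q
  proof (rule ccontr)
    assume "q \<noteq> 0"
    then have "Poly_Mapping.keys q \<noteq> {}" by simp
    moreover have "Poly_Mapping.keys q \<subseteq> {0}" using that(1) by (auto simp: mpoly_over_def)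
    ultimately have "Poly_Mapping.keys q = {0}" by blast
    then show False using that(2) by (auto simp: mpoly_eval_def in_keys_iff)
  qed
  then show ?case by (simp add: algebraically_independent_iff)
next
  case (insert b A)
  have ind: "algebraically_independent K A"
    using insert acl.independent_over_subset by blast
  have "insert b A - {b} = A" using insert(2) by blast
  then have b: "b \<notin> acl (K \<union> A)"
    using insert.prems unfolding acl.independent_over_def by fastforce
  have "q = 0" if q: "mpoly_over K (insert b A) q" "mpoly_eval q = 0" for q
  proof (rule ccontr)
    assume "q \<noteq> 0"
    define M where "M i = {m \<in> Poly_Mapping.keys q. Poly_Mapping.lookup m b = i}" for i
    define \<delta> where "\<delta> m = m - Poly_Mapping.single b (Poly_Mapping.lookup m b)" for m :: "'a \<Rightarrow>\<^sub>0 nat"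
    have fM: "finite (M i)" for i by (simp add: M_def)
    have split: "m = \<delta> m + Poly_Mapping.single b (Poly_Mapping.lookup m b)" for m
      by (rule poly_mapping_eqI) (auto simp: \<delta>_def lookup_add lookup_minus lookup_single when_def)
    have \<delta>: "Poly_Mapping.keys (\<delta> m) \<subseteq> A" if "m \<in> Poly_Mapping.keys q" for m
    proof
      fix c assume "c \<in> Poly_Mapping.keys (\<delta> m)"
      then have "c \<noteq> b" "c \<in> Poly_Mapping.keys m"
        by (auto simp: \<delta>_def in_keys_iff lookup_minus lookup_single when_def split: if_splits)
      then show "c \<in> A" using q(1) that by (auto simp: mpoly_over_def)
    qed
    define p where "p i = (\<Sum>m\<in>M i. Poly_Mapping.single (\<delta> m) (Poly_Mapping.lookup q m))" for i
    have p: "mpoly_over K A (p i)" for i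
      unfolding p_def using q(1)
      by (intro mpoly_over_sum mpoly_over_single \<delta>) (auto simp: M_def mpoly_over_def)
    have ep: "mpoly_eval (p i) \<in> ring_gen (K \<union> A)" for i
      unfolding ring_gen_eq_mpoly_eval using p by blast
    define n where "n = Max ((\<lambda>m. Poly_Mapping.lookup m b) ` Poly_Mapping.keys q)"
    have n: "Poly_Mapping.lookup m b \<le> n" if "m \<in> Poly_Mapping.keys q" for m
      unfolding n_def using that by (intro Max_ge) auto
    define P where "P = (\<Sum>i\<le>n. Polynomial.monom (mpoly_eval (p i)) i)"
    have cP: "Polynomial.coeff P i = (if i \<le> n then mpoly_eval (p i) else 0)" for i
      by (simp add: P_def coeff_sum)
    have "poly P b = (\<Sum>i\<le>n. \<Sum>m\<in>M i. Poly_Mapping.lookup q m * monomial_eval (\<delta> m) * b ^ i)"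
      by (simp add: P_def poly_sum poly_monom p_def mpoly_eval_sum mpoly_eval_single sum_distrib_right)
    also have "\<dots> = (\<Sum>i\<le>n. \<Sum>m\<in>M i. Poly_Mapping.lookup q m * monomial_eval m)"
    proof (intro sum.cong refl)
      fix i m assume "m \<in> M i"
      then have "monomial_eval m = monomial_eval (\<delta> m) * b ^ i"
        using split[of m] monomial_eval_add monomial_eval_single by (metis (mono_tags, lifting) M_def mem_Collect_eq)
      then show "Poly_Mapping.lookup q m * monomial_eval (\<delta> m) * b ^ i = Poly_Mapping.lookup q m * monomial_eval m"
        by simp
    qed
    also have "\<dots> = (\<Sum>m\<in>Poly_Mapping.keys q. Poly_Mapping.lookup q m * monomial_eval m)"
      unfolding M_def by (rule sum.group) (use n in auto)
    also have "\<dots> = 0" using q(2) by (simp add: mpoly_eval_superset[OF finite_keys order_refl])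
    finally have "poly P b = 0" .
    moreover have "poly_over (ring_gen (K \<union> A)) P"
      using ep ring_gen_zero by (auto simp: poly_over_def cP)
    ultimately have "P = 0" using b unfolding acl_def algebraic_over_def by blast
    then have "mpoly_eval (p i) = 0" if "i \<le> n" for i using cP[of i] that by simp
    then have p0: "p i = 0" if "i \<le> n" for i
      using that ind p by (auto simp: algebraically_independent_iff)
    obtain m0 where m0: "m0 \<in> Poly_Mapping.keys q" using \<open>q \<noteq> 0\<close> by (metis ex_in_conv keys_eq_empty)
    let ?i = "Poly_Mapping.lookup m0 b"
    have inj: "\<delta> m = \<delta> m0 \<longleftrightarrow> m = m0" if "m \<in> M ?i" for m
      using that split[of m] split[of m0] by (auto simp: M_def)
    have "Poly_Mapping.lookup (p ?i) (\<delta> m0) = (\<Sum>m\<in>M ?i. if m = m0 then Poly_Mapping.lookup q m else 0)"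
      unfolding p_def by (auto simp: lookup_sum lookup_single when_def inj intro!: sum.cong)
    also have "\<dots> = Poly_Mapping.lookup q m0" using m0 fM by (simp add: M_def)
    finally show False using p0[OF n[OF m0]] m0 by (simp add: in_keys_iff)
  qed
  then show ?case by (simp add: algebraically_independent_iff)
qed

lemma algebraically_independent_imp_independent:
  assumes "algebraically_independent K B"
  shows "acl.independent_over K B"
  unfolding acl.independent_over_def
proof
  fix b assume "b \<in> B"
  then have "insert b (B - {b}) = B" by blast
  then show "b \<notin> acl (K \<union> (B - {b}))"
    using algebraically_independent_imp_notin_acl[of b "B - {b}"] assms by simp
qed

theorem trdeg_eq_card_basis:
  assumes Y: "acl.independent_over K Y" and span: "acl (K \<union> Y) = UNIV"
  shows "trdeg UNIV K = (if finite Y then enat (card Y) else (\<infinity>::enat))"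
proof (cases "finite Y")
  case True
  have "trdeg UNIV K = enat (card Y)"
    unfolding trdeg_def
  proof (rule antisym)
    show "(SUP B\<in>{B. B \<subseteq> UNIV \<and> finite B \<and> algebraically_independent K B}. enat (card B)) \<le> enat (card Y)"
      using acl.steinitz[OF _ algebraically_independent_imp_independent True] span
      by (intro SUP_least) simp
    show "enat (card Y) \<le> (SUP B\<in>{B. B \<subseteq> UNIV \<and> finite B \<and> algebraically_independent K B}. enat (card B))"
      using independent_imp_algebraically_independent[OF True Y] True by (intro SUP_upper) simp
  qed
  then show ?thesis using True by simp
next
  case False
  have "enat n \<le> trdeg UNIV K" for n
  proof -
    obtain B where B: "finite B" "card B = n" "B \<subseteq> Y"
      using infinite_arbitrarily_large[OF False, of n] by blast
    then have "algebraically_independent K B"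
      using independent_imp_algebraically_independent acl.independent_over_subset[OF Y B(3)] by blast
    then show ?thesis
      unfolding trdeg_def using B by (intro SUP_upper2[of B]) auto
  qed
  then have "trdeg UNIV K = (\<infinity>::enat)" by (metis Suc_ile_eq enat.exhaust less_irrefl order_less_imp_le)
  then show ?thesis using False by simp
qed

end

section \<open>Valuations\<close>

locale valued_field =
  fixes v :: "'a::field \<Rightarrow> 'g::linordered_ab_group_add extended"
  assumes valuation: "valuation v"
begin

abbreviation "Ov \<equiv> valuation_ring v"
abbreviation "Mv \<equiv> valuation_ideal v"

text \<open>
  Unspecified at \<open>0\<close>, whose value is infinite.
\<close>

definition w :: "'a \<Rightarrow> 'g" where
  "w x = (THE g. v x = Fin g)"

lemma v_zero [simp]: "v 0 = \<infinity>"
  using valuation by (simp add: valuation_def)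

lemma v_eq_Fin: "x \<noteq> 0 \<Longrightarrow> v x = Fin (w x)"
  using valuation by (cases "v x") (auto simp: valuation_def w_def)

lemma w_mult: "x \<noteq> 0 \<Longrightarrow> y \<noteq> 0 \<Longrightarrow> w (x * y) = w x + w y"
proof -
  assume "x \<noteq> 0" "y \<noteq> 0"
  moreover have "v (x * y) = v x + v y" using valuation by (simp add: valuation_def)
  ultimately show ?thesis by (simp add: v_eq_Fin)
qed

lemma w_one [simp]: "w 1 = 0"
  using w_mult[of 1 1] by simp

lemma w_inverse: "x \<noteq> 0 \<Longrightarrow> w (inverse x) = - w x"
  using w_mult[of x "inverse x"] by (simp add: eq_neg_iff_add_eq_0 add.commute)

lemma w_divide: "x \<noteq> 0 \<Longrightarrow> y \<noteq> 0 \<Longrightarrow> w (x / y) = w x - w y"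
  by (simp add: divide_inverse w_mult w_inverse)

lemma w_minus: "w (- x) = w x"
proof (cases "x = 0")
  case False
  have "w (-1) + w (-1) = 0" using w_mult[of "-1" "-1"] by simp
  then have "w (-1) = 0" by (simp only: double_zero)
  then show ?thesis using w_mult[of "-1" x] False by simp
qed simp

lemma w_add: "x \<noteq> 0 \<Longrightarrow> y \<noteq> 0 \<Longrightarrow> x + y \<noteq> 0 \<Longrightarrow> min (w x) (w y) \<le> w (x + y)"
proof -
  assume "x \<noteq> 0" "y \<noteq> 0" "x + y \<noteq> 0"
  moreover have "min (v x) (v y) \<le> v (x + y)" using valuation by (simp add: valuation_def)
  ultimately show ?thesis by (simp add: v_eq_Fin)
qed

lemma Ov_iff: "x \<in> Ov \<longleftrightarrow> x = 0 \<or> 0 \<le> w x"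
  by (cases "x = 0") (simp_all add: valuation_ring_def v_eq_Fin zero_extended_def)

lemma Mv_iff: "x \<in> Mv \<longleftrightarrow> x = 0 \<or> 0 < w x"
  by (cases "x = 0") (simp_all add: valuation_ideal_def v_eq_Fin zero_extended_def)

lemma Mv_imp_Ov: "x \<in> Mv \<Longrightarrow> x \<in> Ov"
  by (auto simp: Ov_iff Mv_iff)

lemma Ov_zero [simp]: "0 \<in> Ov" and Ov_one [simp]: "1 \<in> Ov"
  and Mv_zero [simp]: "0 \<in> Mv" and Mv_one [simp]: "1 \<notin> Mv"
  by (auto simp: Ov_iff Mv_iff)

lemma Ov_mult: "x \<in> Ov \<Longrightarrow> y \<in> Ov \<Longrightarrow> x * y \<in> Ov"
  by (cases "x = 0 \<or> y = 0") (auto simp: Ov_iff w_mult)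

lemma Mv_mult: "x \<in> Mv \<Longrightarrow> y \<in> Ov \<Longrightarrow> x * y \<in> Mv"
  by (cases "x = 0 \<or> y = 0") (auto simp: Ov_iff Mv_iff w_mult add_pos_nonneg)

lemma Mv_mult2: "x \<in> Ov \<Longrightarrow> y \<in> Mv \<Longrightarrow> x * y \<in> Mv"
  using Mv_mult[of y x] by (simp add: mult.commute)

lemma Ov_power: "x \<in> Ov \<Longrightarrow> x ^ n \<in> Ov"
  by (induction n) (auto intro: Ov_mult)

lemma Ov_minus: "- x \<in> Ov \<longleftrightarrow> x \<in> Ov" and Mv_minus: "- x \<in> Mv \<longleftrightarrow> x \<in> Mv"
  by (auto simp: Ov_iff Mv_iff w_minus)

lemma Ov_add: "x \<in> Ov \<Longrightarrow> y \<in> Ov \<Longrightarrow> x + y \<in> Ov"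
  using w_add[of x y] by (cases "x = 0 \<or> y = 0 \<or> x + y = 0") (auto simp: Ov_iff min_def split: if_splits)

lemma Mv_add: "x \<in> Mv \<Longrightarrow> y \<in> Mv \<Longrightarrow> x + y \<in> Mv"
  using w_add[of x y] by (cases "x = 0 \<or> y = 0 \<or> x + y = 0") (auto simp: Mv_iff min_def split: if_splits)

lemma Ov_diff: "x \<in> Ov \<Longrightarrow> y \<in> Ov \<Longrightarrow> x - y \<in> Ov"
  using Ov_add[of x "- y"] by (simp add: Ov_minus)

lemma Mv_diff: "x \<in> Mv \<Longrightarrow> y \<in> Mv \<Longrightarrow> x - y \<in> Mv"
  using Mv_add[of x "- y"] by (simp add: Mv_minus)

lemma Mv_sum: "(\<And>i. i \<in> I \<Longrightarrow> f i \<in> Mv) \<Longrightarrow> sum f I \<in> Mv"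
  by (induction I rule: infinite_finite_induct) (auto intro: Mv_add)

lemma notin_Ov_iff: "x \<noteq> 0 \<Longrightarrow> x \<notin> Ov \<longleftrightarrow> inverse x \<in> Mv"
  by (auto simp: Ov_iff Mv_iff w_inverse)

lemma notin_Mv_iff: "x \<noteq> 0 \<Longrightarrow> x \<notin> Mv \<longleftrightarrow> inverse x \<in> Ov"
  by (auto simp: Ov_iff Mv_iff w_inverse)

lemma Mv_power_cancel: "x ^ n \<in> Mv \<Longrightarrow> x \<in> Mv"
proof (rule ccontr)
  assume x: "x ^ n \<in> Mv" "x \<notin> Mv"
  then have "x \<noteq> 0" by auto
  then have "inverse (x ^ n) \<in> Ov" using x(2) Ov_power[of "inverse x" n] by (simp add: notin_Mv_iff power_inverse)
  then show False using x(1) \<open>x \<noteq> 0\<close> notin_Mv_iff[of "x ^ n"] by simp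
qed

lemma one_plus_Mv:
  assumes "m \<in> Mv"
  shows "1 + m \<noteq> 0" "1 + m \<in> Ov" "inverse (1 + m) \<in> Ov"
proof -
  show 1: "1 + m \<noteq> 0"
  proof
    assume "1 + m = 0"
    then have "m = - 1" by (simp add: eq_neg_iff_add_eq_0 add.commute)
    then show False using assms Mv_minus[of 1] by simp
  qed
  show "1 + m \<in> Ov" using assms by (intro Ov_add) (auto intro: Mv_imp_Ov)
  have "1 + m \<notin> Mv" using Mv_diff[of "1 + m" m] assms by auto
  then show "inverse (1 + m) \<in> Ov" using 1 notin_Mv_iff by blast
qed

lemma value_le_iff: "r \<noteq> 0 \<Longrightarrow> v r \<le> v x \<longleftrightarrow> x / r \<in> Ov"
  by (cases "x = 0") (auto simp: Ov_iff v_eq_Fin w_divide)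

lemma dense_in_valuedI:
  assumes "\<And>a r. r \<noteq> 0 \<Longrightarrow> \<exists>b\<in>K. (a - b) / r \<in> Ov"
  shows "dense_in_valued v K"
  unfolding dense_in_valued_def
proof (intro allI ballI)
  fix a \<alpha> assume "\<alpha> \<in> value_group v"
  then obtain r where r: "v r = Fin \<alpha>" by (auto simp: value_group_def)
  then have "r \<noteq> 0" by auto
  then show "\<exists>b\<in>K. Fin \<alpha> \<le> v (a - b)"
    using assms[of r a] value_le_iff[of r] r by auto
qed

lemma exists_common_small_factor:
  assumes "Mv \<noteq> {0}" "finite Z"
  shows "\<exists>c. c \<noteq> 0 \<and> (\<forall>x\<in>Z. c * x \<in> Mv)"
  using assms(2)
proof (induction Z)
  case empty
  then show ?case by (intro exI[of _ 1]) simp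
next
  case (insert x Z)
  then obtain c where c: "c \<noteq> 0" "\<forall>x\<in>Z. c * x \<in> Mv" by blast
  obtain p where p: "p \<in> Mv" "p \<noteq> 0" using assms(1) Mv_zero by blast
  show ?case
  proof (cases "c * x \<in> Ov")
    case True
    then show ?thesis using c p
      by (intro exI[of _ "p * c"]) (auto simp: mult.assoc intro: Mv_mult Mv_imp_Ov)
  next
    case False
    then have cx: "c * x \<noteq> 0" by auto
    then have i: "inverse (c * x) \<in> Mv" using False notin_Ov_iff by blast
    have "p * inverse (c * x) * c * x \<in> Mv"
      using p cx by (simp add: field_simps)
    moreover have "p * inverse (c * x) * c * y \<in> Mv" if "y \<in> Z" for y
      using Mv_mult[OF p(1), of "inverse (c * x) * (c * y)"] Mv_mult[OF i, of "c * y"] c(2) that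
      by (simp add: mult.assoc Mv_imp_Ov)
    ultimately show ?thesis using cx p by (intro exI[of _ "p * inverse (c * x) * c"]) auto
  qed
qed

section \<open>Archimedean classes of values\<close>

definition positive :: "'a set" where
  "positive = Mv - {0}"

text \<open>
  The value of \<open>y\<close> exceeds all natural multiples of the value of \<open>x\<close>. For elements of positive value this
  says that the archimedean class of \<open>y\<close> is larger.
\<close>

definition arch_less :: "'a \<Rightarrow> 'a \<Rightarrow> bool" where
  "arch_less x y \<longleftrightarrow> (\<forall>n. y / x ^ n \<in> Mv)"

lemma positiveD: "x \<in> positive \<Longrightarrow> x \<in> Mv" "x \<in> positive \<Longrightarrow> x \<noteq> 0" "x \<in> positive \<Longrightarrow> x \<in> Ov"
  by (auto simp: positive_def Mv_imp_Ov)

lemma arch_lessD: "arch_less x y \<Longrightarrow> y / x \<in> Mv"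
  unfolding arch_less_def by (metis power_one_right)

lemma arch_less_irrefl: "x \<in> positive \<Longrightarrow> \<not> arch_less x x"
  using arch_lessD[of x x] positiveD[of x] by auto

lemma arch_less_Mv_trans:
  assumes "arch_less x y" "y \<noteq> 0" "z / y \<in> Mv"
  shows "arch_less x z"
  unfolding arch_less_def
proof
  fix n
  have "(y / x ^ n) * (z / y) \<in> Mv"
    using assms by (intro Mv_mult Mv_imp_Ov[OF assms(3)]) (auto simp: arch_less_def)
  then show "z / x ^ n \<in> Mv" using assms(2) by simp
qed

lemma arch_less_trans: "y \<in> positive \<Longrightarrow> arch_less x y \<Longrightarrow> arch_less y z \<Longrightarrow> arch_less x z"
  using arch_less_Mv_trans arch_lessD positiveD(2) by blast

text \<open>
  The elements \<open>u\<close> such that all integer multiples of the value of \<open>u\<close> are larger than minus the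
  value of \<open>t\<close>. For \<open>t\<close> of positive value, their values form the largest convex subgroup that does not
  contain the value of \<open>t\<close>.
\<close>

definition negligible_to :: "'a \<Rightarrow> 'a set" where
  "negligible_to t = {u. u \<noteq> 0 \<and> (\<forall>n. t * u ^ n \<in> Mv \<and> t * inverse u ^ n \<in> Mv)}"

lemma negligible_inverse: "u \<in> negligible_to t \<Longrightarrow> inverse u \<in> negligible_to t"
  by (auto simp: negligible_to_def)

lemma negligible_mult:
  assumes "u \<in> negligible_to t" "z \<in> negligible_to t"
  shows "u * z \<in> negligible_to t"
proof -
  have *: "t * (u * z) ^ n \<in> Mv"
    if "\<And>n. t * u ^ n \<in> Mv" "\<And>n. t * z ^ n \<in> Mv" for u z n
  proof -
    have "(t * u ^ (2 * n)) * (t * z ^ (2 * n)) \<in> Mv"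
      by (rule Mv_mult[OF that(1) Mv_imp_Ov[OF that(2)]])
    also have "(t * u ^ (2 * n)) * (t * z ^ (2 * n)) = (t * (u * z) ^ n) ^ 2"
      by (simp add: power_mult_distrib power_mult power2_eq_square mult_ac flip: power_add)
    finally show ?thesis by (rule Mv_power_cancel)
  qed
  show ?thesis
    using assms *[of u z] *[of "inverse u" "inverse z"] by (auto simp: negligible_to_def)
qed

lemma unit_negligible: "t \<in> Mv \<Longrightarrow> u \<noteq> 0 \<Longrightarrow> u \<in> Ov \<Longrightarrow> inverse u \<in> Ov \<Longrightarrow> u \<in> negligible_to t"
  by (auto simp: negligible_to_def intro!: Mv_mult Ov_power)

lemma negligible_power:
  "t \<in> Mv \<Longrightarrow> u \<in> negligible_to t \<Longrightarrow> u ^ n \<in> negligible_to t"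
  by (induction n) (auto intro: negligible_mult unit_negligible)

lemma arch_less_negligible: "s \<in> positive \<Longrightarrow> t \<in> positive \<Longrightarrow> arch_less s t \<Longrightarrow> s \<in> negligible_to t"
  by (auto simp: negligible_to_def arch_less_def divide_inverse power_inverse
      intro!: Mv_mult Ov_power dest: positiveD)

lemma value_group_eq: "value_group v = w ` (UNIV - {0})"
proof (intro equalityI subsetI)
  fix g assume "g \<in> value_group v"
  then obtain x where "v x = Fin g" by (auto simp: value_group_def)
  then show "g \<in> w ` (UNIV - {0})" by (intro image_eqI[of _ _ x]) (auto simp: w_def)
qed (auto simp: value_group_def dest: v_eq_Fin)

lemma convex_subgroup_negligible:
  assumes t: "t \<in> positive"
  shows "convex_subgroup (w ` negligible_to t) (value_group v)"
  unfolding convex_subgroup_def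
proof (intro conjI ballI impI)
  show "w ` negligible_to t \<subseteq> value_group v"
    by (auto simp: value_group_eq negligible_to_def)
  show "0 \<in> w ` negligible_to t"
    using unit_negligible[of t 1] t by (auto simp: positive_def intro!: image_eqI[of _ _ 1])
next
  fix a b assume "a \<in> w ` negligible_to t" "b \<in> w ` negligible_to t"
  then obtain x y where "x \<in> negligible_to t" "y \<in> negligible_to t" "a = w x" "b = w y" by blast
  moreover from this have "a - b = w (x * inverse y)"
    by (simp add: negligible_to_def w_mult w_inverse)
  ultimately show "a - b \<in> w ` negligible_to t" using negligible_mult negligible_inverse by blast
next
  fix a c b assume "a \<in> w ` negligible_to t" "c \<in> w ` negligible_to t" "b \<in> value_group v"
    and le: "a \<le> b \<and> b \<le> c"
  then obtain x z y where x: "x \<in> negligible_to t" "a = w x" and z: "z \<in> negligible_to t" "c = w z"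
    and y: "y \<noteq> 0" "b = w y" by (auto simp: value_group_eq)
  have xz: "x \<noteq> 0" "z \<noteq> 0" using x z by (auto simp: negligible_to_def)
  have O: "y / x \<in> Ov" "z / y \<in> Ov" using le x z y xz by (auto simp: Ov_iff w_divide)
  have "y \<in> negligible_to t"
    unfolding negligible_to_def
  proof (intro CollectI conjI allI y(1))
    fix n
    have "(t * x ^ n) * (y / x) ^ n \<in> Mv"
      using x(1) by (intro Mv_mult[OF _ Ov_power[OF O(1)]]) (simp add: negligible_to_def)
    then show "t * y ^ n \<in> Mv" using xz by (simp add: power_divide)
    have "(t * inverse z ^ n) * (z / y) ^ n \<in> Mv"
      using z(1) by (intro Mv_mult[OF _ Ov_power[OF O(2)]]) (simp add: negligible_to_def)
    also have "(t * inverse z ^ n) * (z / y) ^ n = t * inverse y ^ n"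
      using xz y by (simp add: power_divide power_inverse field_simps)
    finally show "t * inverse y ^ n \<in> Mv" .
  qed
  then show "b \<in> w ` negligible_to t" using y(2) by blast
qed

text \<open>
  If \<open>t\<close> had the largest archimedean class, then every convex subgroup containing the value of \<open>t\<close>
  would be the whole value group. So the largest convex subgroup that does not contain this value
  would be a maximal proper one.
\<close>

lemma exists_arch_greater:
  assumes no_max: "\<not> (\<exists>C. maximal_proper_convex_subgroup C (value_group v))"
    and t: "t \<in> positive"
  shows "\<exists>y\<in>positive. arch_less t y"
proof (rule ccontr)
  assume "\<not> ?thesis"
  then have bound: "\<exists>n. y / t ^ n \<notin> Mv" if "y \<in> positive" for y
    using that by (auto simp: arch_less_def)
  have tnz: "t \<noteq> 0" using t positiveD by blast
  have "maximal_proper_convex_subgroup (w ` negligible_to t) (value_group v)"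
    unfolding maximal_proper_convex_subgroup_def
  proof (intro conjI allI impI)
    show "convex_subgroup (w ` negligible_to t) (value_group v)"
      by (rule convex_subgroup_negligible[OF t])
    show "w ` negligible_to t \<noteq> value_group v"
    proof
      assume "w ` negligible_to t = value_group v"
      then have "w t \<in> w ` negligible_to t" using tnz by (auto simp: value_group_eq)
      then obtain u where u: "u \<in> negligible_to t" "w t = w u" by blast
      then have "t * inverse u ^ 1 \<in> Mv" "u \<noteq> 0" unfolding negligible_to_def by blast+
      then show False using u(2) tnz by (simp add: Mv_iff w_mult w_inverse)
    qed
  next
    fix D assume D: "convex_subgroup D (value_group v) \<and> D \<noteq> value_group v \<and> w ` negligible_to t \<subseteq> D"
    then have sub: "D \<subseteq> value_group v" and zero: "0 \<in> D" and diff': "\<forall>a\<in>D. \<forall>b\<in>D. a - b \<in> D"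
      and conv': "\<forall>a\<in>D. \<forall>c\<in>D. \<forall>b\<in>value_group v. a \<le> b \<and> b \<le> c \<longrightarrow> b \<in> D"
      unfolding convex_subgroup_def by - (elim conjE, assumption)+
    have diff: "a - b \<in> D" if "a \<in> D" "b \<in> D" for a b
      using diff' that by simp
    have conv: "b \<in> D" if "a \<in> D" "c \<in> D" "b \<in> value_group v" "a \<le> b" "b \<le> c" for a b c
      using conv' that by (meson)
    have minus: "- a \<in> D" if "a \<in> D" for a using diff[OF zero that] by simp
    have power: "w (z ^ n) \<in> D" if "z \<noteq> 0" "w z \<in> D" for z n
    proof (induction n)
      case (Suc n)
      have "w (z ^ Suc n) = w z - (- w (z ^ n))" using that by (simp add: w_mult)
      then show ?case using diff[OF that(2) minus[OF Suc]] by simp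
    qed (simp add: zero)
    have below: "w y \<in> D" if "z \<noteq> 0" "w z \<in> D" "y \<in> Ov" "y \<noteq> 0" "z / y \<in> Ov" for y z
      using that by (intro conv[OF zero that(2)]) (auto simp: value_group_eq Ov_iff w_divide)
    show "D = w ` negligible_to t"
    proof (rule ccontr)
      assume "D \<noteq> w ` negligible_to t"
      then obtain d where d: "d \<in> D" "d \<notin> w ` negligible_to t" using D by blast
      moreover from d(1) obtain z where "z \<noteq> 0" "d = w z"
        using sub by (auto simp: value_group_eq)
      ultimately have z: "z \<noteq> 0" "d = w z" "z \<notin> negligible_to t" by blast+
      obtain n where "t * z ^ n \<notin> Mv \<or> t * inverse z ^ n \<notin> Mv"
        using z by (auto simp: negligible_to_def)
      moreover have "w t \<in> D" if "t * u ^ n \<notin> Mv" "u \<noteq> 0" "w u \<in> D" for u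
      proof (rule below[of "inverse (u ^ n)"])
        show "inverse (u ^ n) / t \<in> Ov"
          using that tnz notin_Mv_iff[of "t * u ^ n"] by (simp add: divide_inverse mult_ac)
        show "w (inverse (u ^ n)) \<in> D" using power[of u n] minus that by (simp add: w_inverse)
      qed (use that t tnz in \<open>auto dest: positiveD\<close>)
      moreover have "w z \<in> D" "w (inverse z) \<in> D" using d z minus by (auto simp: w_inverse)
      ultimately have wt: "w t \<in> D" using z(1) by (metis inverse_zero_imp_zero)
      have pos: "w y \<in> D" if y: "y \<in> positive" for y
      proof -
        obtain n where n: "y / t ^ n \<notin> Mv" using bound[OF y] by blast
        show ?thesis
        proof (rule below[of "t ^ n"])
          show "t ^ n / y \<in> Ov"
            using n y tnz notin_Mv_iff[of "y / t ^ n"] by (auto simp: positive_def divide_inverse mult_ac)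
        qed (use tnz power[OF tnz wt] y in \<open>auto dest: positiveD\<close>)
      qed
      have "value_group v \<subseteq> D"
      proof
        fix g assume "g \<in> value_group v"
        then obtain y where y: "y \<noteq> 0" "g = w y" by (auto simp: value_group_eq)
        consider "y \<in> positive" | "inverse y \<in> positive" | "w y = 0"
          using y less_linear[of "w y" 0] by (auto simp: positive_def Mv_iff w_inverse)
        then show "g \<in> D"
        proof cases
          case 2
          then show ?thesis using pos[OF 2] minus y by (fastforce simp: w_inverse)
        qed (use y pos zero in auto)
      qed
      then show False using D sub by blast
    qed
  qed
  then show False using no_max by blast
qed

end

context valued_field
begin

section \<open>Residue characteristic zero\<close>

text \<open>
  This links the characteristic of the residue field to the values of natural numbers: the coset is
  the zero of the residue field if and only if \<open>n\<close> lies in the valuation ideal.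
\<close>

lemma of_nat_multiple_of_one_residue_field:
  "[n] \<cdot>\<^bsub>residue_field v\<^esub> \<one>\<^bsub>residue_field v\<^esub> = {m + of_nat n | m. m \<in> Mv}"
proof (induction n)
  case 0
  then show ?case
    by (simp add: add_pow_def nat_pow_def residue_field_def FactRing_def)
next
  case (Suc n)
  have "[Suc n] \<cdot>\<^bsub>residue_field v\<^esub> \<one>\<^bsub>residue_field v\<^esub> =
      [n] \<cdot>\<^bsub>residue_field v\<^esub> \<one>\<^bsub>residue_field v\<^esub> \<oplus>\<^bsub>residue_field v\<^esub> \<one>\<^bsub>residue_field v\<^esub>"
    by (simp add: add_pow_def nat_pow_def)
  also have "\<dots> = {a + b | a b. a \<in> {m + of_nat n | m. m \<in> Mv} \<and> b \<in> {m + 1 | m. m \<in> Mv}}"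
    unfolding Suc
    by (auto simp: residue_field_def FactRing_def set_add_def set_mult_def a_r_coset_def r_coset_def
        ring_on_def)
  also have "\<dots> = {m + of_nat (Suc n) | m. m \<in> Mv}"
  proof (intro equalityI subsetI)
    fix x assume "x \<in> {a + b | a b. a \<in> {m + of_nat n | m. m \<in> Mv} \<and> b \<in> {m + 1 | m. m \<in> Mv}}"
    then obtain m m' where "m \<in> Mv" "m' \<in> Mv" "x = (m + of_nat n) + (m' + 1)" by blast
    then show "x \<in> {m + of_nat (Suc n) | m. m \<in> Mv}"
      by (intro CollectI exI[of _ "m + m'"]) (auto intro: Mv_add)
  next
    fix x assume "x \<in> {m + of_nat (Suc n) | m. m \<in> Mv}"
    then obtain m where "m \<in> Mv" "x = (m + of_nat n) + (0 + 1)" by auto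
    then show "x \<in> {a + b | a b. a \<in> {m + of_nat n | m. m \<in> Mv} \<and> b \<in> {m + 1 | m. m \<in> Mv}}"
      using Mv_zero by blast
  qed
  finally show ?case .
qed

end

locale residue_char_0 = valued_field +
  assumes residue_char: "characteristic_zero (residue_field v)"
begin

lemma of_nat_notin_Mv: "0 < n \<Longrightarrow> of_nat n \<notin> Mv"
proof
  assume n: "0 < n" "of_nat n \<in> Mv"
  have "{m + of_nat n | m. m \<in> Mv} = Mv"
  proof (intro equalityI subsetI)
    fix x assume "x \<in> Mv"
    then show "x \<in> {m + of_nat n | m. m \<in> Mv}"
      using Mv_diff[OF _ n(2)] by (intro CollectI exI[of _ "x - of_nat n"]) auto
  qed (use n(2) in \<open>auto intro: Mv_add\<close>)
  moreover have "\<zero>\<^bsub>residue_field v\<^esub> = Mv" by (simp add: residue_field_def FactRing_def)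
  ultimately show False
    using residue_char n(1) of_nat_multiple_of_one_residue_field[of n]
    unfolding characteristic_zero_def by auto
qed

lemma of_nat_in_Ov: "of_nat n \<in> Ov"
  by (induction n) (auto intro: Ov_add)

lemma of_nat_neq_0: "0 < n \<Longrightarrow> (of_nat n :: 'a) \<noteq> 0"
  using of_nat_notin_Mv Mv_zero by metis

lemma pderiv_neq_0:
  assumes "0 < Polynomial.degree (p :: 'a poly)"
  shows "pderiv p \<noteq> 0"
proof
  assume "pderiv p = 0"
  then have "Polynomial.coeff (pderiv p) (Polynomial.degree p - 1) = 0" by simp
  then show False using assms of_nat_neq_0[OF assms] by (auto simp: coeff_pderiv)
qed

lemma pderiv_degree_less:
  assumes "0 < Polynomial.degree (p :: 'a poly)"
  shows "Polynomial.degree (pderiv p) < Polynomial.degree p"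
proof -
  have "Polynomial.degree (pderiv p) \<le> Polynomial.degree p - 1"
    by (rule degree_le) (auto simp: coeff_pderiv coeff_eq_0)
  then show ?thesis using assms by simp
qed

section \<open>Independence of elements of distinct archimedean classes\<close>

lemma ring_gen_empty_negligible:
  assumes t: "t \<in> positive" and u: "u \<in> ring_gen {}" "u \<noteq> 0"
  shows "u \<in> negligible_to t"
proof -
  have "ring_gen {} \<subseteq> (range of_int :: 'a set)"
  proof (rule ring_gen_least)
    show "(1::'a) \<in> range of_int" by (rule image_eqI[of _ _ 1]) auto
  next
    fix a b :: 'a assume "a \<in> range of_int" "b \<in> range of_int"
    then obtain k l where "a = of_int k" "b = of_int l" by blast
    then show "a - b \<in> range of_int" "a * b \<in> range of_int"
      by (auto simp flip: of_int_diff of_int_mult)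
  qed simp
  then obtain k where k: "u = of_int k" using u(1) by blast
  obtain n where n: "k = int n \<or> k = - int n" by (metis int_cases2)
  then have "u = of_nat n \<or> u = - of_nat n" using k by auto
  moreover from this have "0 < n" using u(2) by (cases n) auto
  ultimately have "u \<in> Ov" "u \<notin> Mv"
    using of_nat_notin_Mv of_nat_in_Ov by (auto simp: Ov_minus Mv_minus)
  then show ?thesis using u(2) t notin_Mv_iff by (intro unit_negligible) (auto dest: positiveD)
qed

text \<open>
  If the values of the coefficients are negligible against that of \<open>t\<close>, then the nonzero term of lowest
  degree dominates all others.
\<close>

lemma poly_dominant_term:
  assumes t: "t \<in> positive" and R: "\<And>u. u \<in> R \<Longrightarrow> u \<noteq> 0 \<Longrightarrow> u \<in> negligible_to t" "0 \<in> R"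
    and p: "p \<noteq> 0" "poly_over R p"
  shows "\<exists>c i m. c \<in> R \<and> c \<noteq> 0 \<and> m \<in> Mv \<and> poly p t = c * t ^ i * (1 + m)"
  using p
proof (induction p)
  case 0
  then show ?case by simp
next
  case (pCons a q)
  have aR: "a \<in> R" and qR: "poly_over R q" using pCons.prems R(2) by (auto simp: poly_over_pCons)
  show ?case
  proof (cases "q = 0")
    case True
    then have "poly (pCons a q) t = a * t ^ 0 * (1 + 0)" "a \<noteq> 0" using pCons.prems by auto
    then show ?thesis using aR Mv_zero by blast
  next
    case False
    then obtain c i m where c: "c \<in> R" "c \<noteq> 0" "m \<in> Mv" "poly q t = c * t ^ i * (1 + m)"
      using pCons.IH qR by blast
    show ?thesis
    proof (cases "a = 0")
      case True
      then have "poly (pCons a q) t = c * t ^ Suc i * (1 + m)" using c(4) by simp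
      then show ?thesis using c by blast
    next
      case False
      have "c * inverse a \<in> negligible_to t"
        using R(1) aR c False by (intro negligible_mult negligible_inverse) auto
      then have "t * (c * inverse a) ^ 1 \<in> Mv" unfolding negligible_to_def by blast
      then have tc: "t * (c * inverse a) \<in> Mv" by simp
      have "(t * (c * inverse a)) * (t ^ i * (1 + m)) \<in> Mv" (is "?m \<in> Mv")
        using one_plus_Mv[OF c(3)] t by (intro Mv_mult[OF tc] Ov_mult Ov_power) (auto dest: positiveD)
      moreover have "poly (pCons a q) t = a * t ^ 0 * (1 + ?m)"
        using False c(4) by (simp add: field_simps)
      ultimately show ?thesis using aR False by blast
    qed
  qed
qed

definition arch_chain :: "'a set \<Rightarrow> bool" where
  "arch_chain S \<longleftrightarrow> S \<subseteq> positive \<and> (\<forall>x\<in>S. \<forall>y\<in>S. x \<noteq> y \<longrightarrow> arch_less x y \<or> arch_less y x)"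

lemma arch_less_if_value_le:
  assumes "arch_chain S" "x \<in> S" "y \<in> S" "x \<noteq> y" "v x \<le> v y"
  shows "arch_less x y"
proof (rule ccontr)
  assume "\<not> arch_less x y"
  then have "arch_less y x" using assms by (auto simp: arch_chain_def)
  then have "x / y \<in> Mv" by (rule arch_lessD)
  moreover have "y / x \<in> Ov" "x \<noteq> 0" "y \<noteq> 0"
    using assms value_le_iff[of x y] by (auto simp: arch_chain_def dest: positiveD)
  ultimately show False using Mv_mult[of "x / y" "y / x"] by simp
qed

text \<open>
  Adjoin the elements of \<open>F\<close> in the order of increasing value. A polynomial expression in the new element
  \<open>s\<close> is a coefficient times a power of \<open>s\<close>, up to a factor \<open>1 + m\<close> which is a unit, and each of
  these is negligible against \<open>t\<close>.
\<close>

lemma ring_gen_negligible: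
  assumes "finite F" "arch_chain F" "t \<in> positive" "\<And>s. s \<in> F \<Longrightarrow> arch_less s t"
    and "u \<in> ring_gen F" "u \<noteq> 0"
  shows "u \<in> negligible_to t"
  using assms
proof (induction F arbitrary: t u rule: finite_ranking_induct[where f = v])
  case empty
  then show ?case using ring_gen_empty_negligible by blast
next
  case (insert s F)
  show ?case
  proof (cases "s \<in> F")
    case True
    then have "insert s F = F" by blast
    then show ?thesis using insert.IH[OF _ insert.prems(2) _ _ insert.prems(5)] insert.prems by simp
  next
    case False
    have s: "s \<in> positive" and F: "arch_chain F" using insert.prems(1) by (auto simp: arch_chain_def)
    have less: "arch_less y s" if "y \<in> F" for y
      using arch_less_if_value_le[OF insert.prems(1), of y s] insert.hyps(2)[OF that] that False by auto
    obtain q where q: "poly_over (ring_gen F) q" "u = poly q s"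
      using insert.prems(4) unfolding ring_gen_insert by blast
    have "q \<noteq> 0" using q(2) insert.prems(5) by auto
    moreover have "z \<in> negligible_to s" if "z \<in> ring_gen F" "z \<noteq> 0" for z
      using insert.IH[OF F s less that] by blast
    ultimately obtain c i m where c: "c \<in> ring_gen F" "c \<noteq> 0" "m \<in> Mv" "u = c * s ^ i * (1 + m)"
      using poly_dominant_term[OF s _ ring_gen_zero _ q(1)] q(2) by blast
    have tM: "t \<in> Mv" using insert.prems(2) positiveD by blast
    have "c \<in> negligible_to t"
      by (rule insert.IH[OF F insert.prems(2) insert.prems(3) c(1,2)]) simp
    moreover have "s \<in> negligible_to t"
      using s insert.prems by (intro arch_less_negligible) auto
    moreover have "1 + m \<in> negligible_to t"
      using one_plus_Mv[OF c(3)] by (intro unit_negligible tM)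
    ultimately show ?thesis unfolding c(4) by (intro negligible_mult negligible_power tM)
  qed
qed

lemma top_notin_acl:
  assumes "finite F" "arch_chain F" "t \<in> positive" "\<And>s. s \<in> F \<Longrightarrow> arch_less s t"
  shows "t \<notin> acl F"
proof
  assume "t \<in> acl F"
  then obtain p where p: "p \<noteq> 0" "poly_over (ring_gen F) p" "poly p t = 0"
    unfolding acl_def algebraic_over_def by blast
  obtain c i m where "c \<noteq> 0" "m \<in> Mv" "poly p t = c * t ^ i * (1 + m)"
    using poly_dominant_term[OF assms(3) ring_gen_negligible[OF assms] ring_gen_zero p(1,2)] by blast
  then show False using p(3) one_plus_Mv(1) assms(3) by (auto dest: positiveD)
qed

text \<open>
  The element of largest value is independent of the others by \<open>top_notin_acl\<close>. If this is some
  \<open>t \<noteq> s\<close>, the exchange property carries the statement over to \<open>s\<close>.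
\<close>

lemma notin_acl_finite:
  assumes "finite F" "arch_chain (insert s F)" "s \<notin> F"
  shows "s \<notin> acl F"
  using assms
proof (induction F rule: finite_ranking_induct[where f = v])
  case empty
  then show ?case using top_notin_acl[of "{}" s] by (simp add: arch_chain_def)
next
  case (insert t F)
  show ?case
  proof (cases "t \<in> F")
    case True
    then have "insert t F = F" by blast
    then show ?thesis using insert by simp
  next
    case False
    have sub: "insert s F \<subseteq> insert s (insert t F)" by blast
    have chain: "arch_chain (insert t F)" "arch_chain (insert s F)"
      using insert.prems(1) unfolding arch_chain_def by blast+
    have st: "s \<in> positive" "t \<in> positive" "s \<noteq> t" using insert.prems by (auto simp: arch_chain_def)
    have less: "arch_less y t" if "y \<in> F" for y
      using arch_less_if_value_le[OF chain(1), of y t] insert.hyps(2)[OF that] that False by auto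
    consider "arch_less t s" | "arch_less s t"
      using insert.prems by (auto simp: arch_chain_def)
    then show ?thesis
    proof cases
      case 1
      have "arch_less y s" if "y \<in> insert t F" for y
        using that less 1 st arch_less_trans by blast
      then show ?thesis using top_notin_acl chain(1) st(1) insert.hyps(1) by blast
    next
      case 2
      have "t \<notin> acl (insert s F)"
        using top_notin_acl[of "insert s F" t] chain(2) st less 2 insert.hyps(1) by blast
      moreover have "s \<notin> acl F" using insert.IH chain(2) insert.prems(2) by blast
      ultimately show ?thesis using acl_exchange by blast
    qed
  qed
qed

lemma arch_chain_independent:
  assumes "arch_chain S"
  shows "acl.independent_over {} S"
  unfolding acl.independent_over_def
proof (intro ballI notI)
  fix s assume s: "s \<in> S" "s \<in> acl ({} \<union> (S - {s}))"
  then obtain F where F: "finite F" "F \<subseteq> S - {s}" "s \<in> acl F"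
    using acl_finite_subset[OF s(2)] by auto
  have "arch_chain (insert s F)" using assms s(1) F(2) unfolding arch_chain_def by blast
  moreover have "s \<notin> F" using F(2) by blast
  ultimately show False using notin_acl_finite F by blast
qed

section \<open>Cofinal families\<close>

text \<open>
  Iterating \<open>nxt\<close> from a starting point gives an increasing sequence of archimedean classes. Take a
  maximal set \<open>B\<close> of starting points whose sequences lie entirely one above the other, and sort the
  terms of each sequence into infinitely many infinite subsequences by the pairing function. If the
  \<open>k\<close>-th subsequences all stayed below some \<open>r\<close>, then so would all terms, since the sequences
  increase, and \<open>r\<close> could be added to \<open>B\<close>.
\<close>

lemma exists_cofinal_families:
  assumes nontriv: "positive \<noteq> {}"
    and greater: "\<And>t. t \<in> positive \<Longrightarrow> \<exists>y\<in>positive. arch_less t y"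
  shows "\<exists>S f. arch_chain S \<and> (\<forall>k::nat. \<forall>r. r \<noteq> 0 \<longrightarrow> (\<exists>s\<in>S. f s = k \<and> s / r \<in> Ov))"
proof -
  obtain nxt where nxt: "\<And>t. t \<in> positive \<Longrightarrow> nxt t \<in> positive"
    "\<And>t. t \<in> positive \<Longrightarrow> arch_less t (nxt t)"
    using greater by metis
  define it where "it n x = (nxt ^^ n) x" for n :: nat and x
  have it0: "it 0 x = x" and itS: "it (Suc n) x = nxt (it n x)" for x n
    by (simp_all add: it_def)
  have it_pos: "it n x \<in> positive" if "x \<in> positive" for n x
    by (induction n) (use that in \<open>auto simp: it0 itS intro: nxt\<close>)
  have it_less: "arch_less (it n x) (it m x)" if "x \<in> positive" "n < m" for n m x
    using that(2)
  proof (induction m)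
    case (Suc m)
    show ?case
    proof (cases "n = m")
      case True
      then show ?thesis using nxt(2)[OF it_pos[OF that(1)]] by (simp add: itS)
    next
      case False
      then have "arch_less (it n x) (it m x)" using Suc by simp
      then show ?thesis
        using arch_less_trans[OF it_pos[OF that(1), of m]] nxt(2)[OF it_pos[OF that(1)]] by (simp add: itS)
    qed
  qed simp
  define sep where "sep x y \<longleftrightarrow> (\<forall>n. arch_less (it n x) y)" for x y
  define fam where "fam = {B. B \<subseteq> positive \<and> (\<forall>x\<in>B. \<forall>y\<in>B. x \<noteq> y \<longrightarrow> sep x y \<or> sep y x)}"
  have "\<exists>M\<in>fam. \<forall>B\<in>fam. M \<subseteq> B \<longrightarrow> B = M"
  proof (rule subset_Zorn')
    fix C assume C: "subset.chain fam C"
    show "\<Union>C \<in> fam"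
      unfolding fam_def
    proof (intro CollectI conjI ballI impI)
      show "\<Union>C \<subseteq> positive" using C by (auto simp: subset_chain_def fam_def)
      fix x y assume "x \<in> \<Union>C" "y \<in> \<Union>C" and ne: "x \<noteq> y"
      then obtain B B' where B: "x \<in> B" "B \<in> C" "y \<in> B'" "B' \<in> C" by blast
      then have "B \<subseteq> B' \<or> B' \<subseteq> B" using C by (auto simp: subset_chain_def)
      then obtain B'' where "B'' \<in> C" "x \<in> B''" "y \<in> B''" using B by blast
      moreover from this have "B'' \<in> fam" using C by (auto simp: subset_chain_def)
      ultimately show "sep x y \<or> sep y x" using ne by (auto simp: fam_def)
    qed
  qed
  then obtain B where B: "B \<in> fam" and B_max: "\<forall>B'\<in>fam. B \<subseteq> B' \<longrightarrow> B' = B"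
    by (elim bexE)
  have Bpos: "B \<subseteq> positive" and Bsep: "\<And>x y. x \<in> B \<Longrightarrow> y \<in> B \<Longrightarrow> x \<noteq> y \<Longrightarrow> sep x y \<or> sep y x"
    using B by (auto simp: fam_def)
  have sep_less: "arch_less (it n x) (it m y)" if "sep x y" "y \<in> positive" for n m x y
  proof (cases "m = 0")
    case True
    then show ?thesis using that by (simp add: sep_def it0)
  next
    case False
    then have "arch_less y (it m y)" using it_less[OF that(2), of 0 m] by (simp add: it0)
    then show ?thesis using that arch_less_trans unfolding sep_def by blast
  qed
  have comparable: "arch_less (it n x) (it m y) \<or> arch_less (it m y) (it n x) \<or> n = m \<and> x = y"
    if "x \<in> B" "y \<in> B" for n m x y
  proof (cases "x = y")
    case True
    then show ?thesis using it_less[of x] that Bpos by (cases n m rule: linorder_cases) blast+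
  next
    case False
    then show ?thesis using Bsep[OF that False] sep_less that Bpos by blast
  qed
  define S where "S = {it n x | n x. x \<in> B}"
  define f where "f s = fst (prod_decode (SOME n. \<exists>x\<in>B. s = it n x))" for s
  have chain: "arch_chain S"
    unfolding arch_chain_def S_def using comparable it_pos Bpos by blast
  have f: "f (it n x) = fst (prod_decode n)" if x: "x \<in> B" for n x
  proof -
    have "(SOME k. \<exists>y\<in>B. it n x = it k y) = n"
    proof (rule some_equality)
      show "\<exists>y\<in>B. it n x = it n y" using x by blast
      fix k assume "\<exists>y\<in>B. it n x = it k y"
      then obtain y where y: "y \<in> B" "it n x = it k y" by blast
      show "k = n" 
        using comparable[OF x y(1), of n k] y(2) arch_less_irrefl[OF it_pos, of x n] x Bpos by auto
    qed
    then show ?thesis by (simp add: f_def)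
  qed
  have cofinal: "\<exists>s\<in>S. f s = k \<and> s / r \<in> Ov" if r: "r \<in> positive" for k r
  proof (rule ccontr)
    assume no: "\<not> ?thesis"
    \<comment> \<open>The terms of the \<open>k\<close>-th subsequences have smaller value than \<open>r\<close>.\<close>
    have small: "r / it (prod_encode (k, m)) x \<in> Mv" if x: "x \<in> B" for m x
    proof -
      have "it (prod_encode (k, m)) x \<in> S" using x by (auto simp: S_def)
      then have "it (prod_encode (k, m)) x / r \<notin> Ov" using no f[OF x, of "prod_encode (k, m)"] by auto
      moreover have "it (prod_encode (k, m)) x / r \<noteq> 0"
        using it_pos[of x] x Bpos r by (auto dest: positiveD)
      ultimately show ?thesis using notin_Ov_iff by fastforce
    qed
    have sepr: "sep x r" if x: "x \<in> B" for x
      unfolding sep_def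
    proof
      fix n
      let ?m = "prod_encode (k, Suc n)"
      have "n < ?m" using le_prod_encode_2[of "Suc n" k] by simp
      then have "arch_less (it n x) (it ?m x)" using it_less x Bpos by blast
      then show "arch_less (it n x) r"
        using arch_less_Mv_trans[OF _ _ small[OF x, of "Suc n"]] it_pos[of x ?m] x Bpos
        by (auto dest: positiveD)
    qed
    then have "insert r B \<in> fam" using B r by (auto simp: fam_def)
    then have "insert r B = B" using bspec[OF B_max, of "insert r B"] by (simp add: subset_insertI)
    then have "r \<in> B" by blast
    then have "arch_less (it 0 r) r" using sepr unfolding sep_def by blast
    then show False using arch_less_irrefl[OF r] by (simp add: it0)
  qed
  \<comment> \<open>For \<open>r\<close> without positive value any bound \<open>p\<close> of positive value does.\<close>
  obtain p where p: "p \<in> positive" using nontriv by blast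
  have "\<exists>s\<in>S. f s = k \<and> s / r \<in> Ov" if r: "r \<noteq> 0" for k r
  proof (cases "r \<in> positive")
    case True
    then show ?thesis by (rule cofinal)
  next
    case False
    then have "inverse r \<in> Ov" using r notin_Mv_iff[OF r] by (auto simp: positive_def)
    moreover obtain s where s: "s \<in> S" "f s = k" "s / p \<in> Ov" using cofinal[OF p] by blast
    ultimately have "(s / p) * (p * inverse r) \<in> Ov" using p by (intro Ov_mult) (auto dest: positiveD)
    also have "(s / p) * (p * inverse r) = s / r" using positiveD(2)[OF p] by (simp add: field_simps)
    finally have "s / r \<in> Ov" .
    then show ?thesis using s by blast
  qed
  then show ?thesis using chain by blast
qed

end

section \<open>The topological closure of a relatively algebraically closed subfield\<close>

context valued_field
begin

text \<open>
  The topological closure. The condition that \<open>a - b\<close> has at least the value of \<open>r\<close> is expressed by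
  the quotient, so that the closure properties of the valuation ring apply directly.
\<close>

definition vclosure :: "'a set \<Rightarrow> 'a set" where
  "vclosure K = {a. \<forall>r. r \<noteq> 0 \<longrightarrow> (\<exists>b\<in>K. (a - b) / r \<in> Ov)}"

lemma vclosureD: "a \<in> vclosure K \<Longrightarrow> r \<noteq> 0 \<Longrightarrow> \<exists>b\<in>K. (a - b) / r \<in> Ov"
  by (simp add: vclosure_def)

lemma subset_vclosure: "K \<subseteq> vclosure K"
  by (auto simp: vclosure_def intro!: bexI)

lemma dense_if_vclosure_UNIV: "vclosure K = UNIV \<Longrightarrow> dense_in_valued v K"
  by (rule dense_in_valuedI) (use vclosureD in blast)

lemma ring_gen_vclosure:
  assumes "ring_gen K = K"
  shows "ring_gen (vclosure K) = vclosure K"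
proof
  show "ring_gen (vclosure K) \<subseteq> vclosure K"
  proof (rule ring_gen_least)
    show "1 \<in> vclosure K" using subset_vclosure ring_gen.one[of K] assms by auto
  next
    fix a a' assume a: "a \<in> vclosure K" "a' \<in> vclosure K"
    show "a - a' \<in> vclosure K"
      unfolding vclosure_def
    proof (intro CollectI allI impI)
      fix r :: 'a assume "r \<noteq> 0"
      then obtain b b' where b: "b \<in> K" "(a - b) / r \<in> Ov" "b' \<in> K" "(a' - b') / r \<in> Ov"
        using a vclosureD by metis
      have "(a - b) / r - (a' - b') / r \<in> Ov" using b by (intro Ov_diff)
      then have "(a - a' - (b - b')) / r \<in> Ov" by (simp add: diff_divide_distrib add_divide_distrib algebra_simps)
      moreover have "b - b' \<in> K" using ring_gen.diff[of b K b'] b assms by simp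
      ultimately show "\<exists>b\<in>K. (a - a' - b) / r \<in> Ov" by blast
    qed
    show "a * a' \<in> vclosure K"
      unfolding vclosure_def
    proof (intro CollectI allI impI)
      fix r :: 'a assume r: "r \<noteq> 0"
      obtain b' where b': "b' \<in> K" "a * (a' - b') / r \<in> Ov"
      proof (cases "a = 0")
        case True
        then show ?thesis using that[of 1] ring_gen.one[of K] assms by simp
      next
        case False
        then obtain b' where "b' \<in> K" "(a' - b') / (r / a) \<in> Ov" using vclosureD[OF a(2), of "r / a"] r by auto
        then show ?thesis using that[of b'] by (simp add: mult.commute)
      qed
      obtain b where b: "b \<in> K" "b' * (a - b) / r \<in> Ov"
      proof (cases "b' = 0")
        case True
        then show ?thesis using that[of 1] ring_gen.one[of K] assms by simp
      next
        case False
        then obtain b where "b \<in> K" "(a - b) / (r / b') \<in> Ov" using vclosureD[OF a(1), of "r / b'"] r by auto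
        then show ?thesis using that[of b] by (simp add: mult.commute)
      qed
      have "a * (a' - b') / r + b' * (a - b) / r \<in> Ov" using b b' by (intro Ov_add)
      also have "a * (a' - b') / r + b' * (a - b) / r = (a * a' - b * b') / r"
        by (simp add: algebra_simps flip: add_divide_distrib)
      finally have "(a * a' - b * b') / r \<in> Ov" .
      moreover have "b * b' \<in> K" using ring_gen.mult[of b K b'] b b' assms by simp
      ultimately show "\<exists>b\<in>K. (a * a' - b) / r \<in> Ov" by blast
    qed
  qed simp
qed (auto intro: ring_gen.base)

end

context residue_char_0
begin

text \<open>
  A simple root persists under small perturbations of the coefficients. After the substitution
  \<open>Z \<mapsto> x + c Z\<close> and division by \<open>c p'(x)\<close>, the polynomial \<open>p\<close> becomes \<open>Z\<close> plus terms of positive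
  value, provided that \<open>c\<close> has large value. A sufficiently good approximation \<open>q\<close> of \<open>p\<close> still yields a
  polynomial of this form, which by Hensel's Lemma has a root in the valuation ring.
\<close>

lemma root_of_approximating_polynomial:
  assumes hens: "henselian v UNIV" and nontriv: "Mv \<noteq> {0}"
    and p: "poly p x = 0" "poly (pderiv p) x \<noteq> 0" "\<And>i. Polynomial.coeff p i \<in> vclosure K"
    and K: "0 \<in> K" and r: "r \<noteq> 0"
  shows "\<exists>q b. q \<noteq> 0 \<and> poly_over K q \<and> poly q b = 0 \<and> (x - b) / r \<in> Ov"
proof -
  define n where "n = Polynomial.degree p"
  define D where "D = poly (pderiv p) x"
  define P where "P = pcompose p [:x, 1:]"
  have D: "D \<noteq> 0" using p(2) by (simp add: D_def)
  have P0: "Polynomial.coeff P 0 = 0" using p(1) by (simp add: P_def)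
  have "Polynomial.coeff (pderiv P) 0 = D"
    by (simp add: P_def D_def pderiv_pcompose pderiv_pCons coeff_mult_0)
  then have P1: "Polynomial.coeff P 1 = D" by (simp add: coeff_pderiv)
  have dP: "Polynomial.degree P = n" by (simp add: P_def n_def degree_pcompose)
  \<comment> \<open>The scale \<open>c\<close> makes all Taylor coefficients of degree at least two small.\<close>
  obtain c where c: "c \<noteq> 0" "c * inverse r \<in> Mv" "c * 1 \<in> Mv"
    "\<And>j. j \<le> n \<Longrightarrow> c * (Polynomial.coeff P j / D) \<in> Mv"
    using exists_common_small_factor[OF nontriv,
        of "{inverse r, 1} \<union> (\<lambda>j. Polynomial.coeff P j / D) ` {..n}"] by auto
  define L where "L = [:x, c:]"
  have comp: "pcompose p L = pcompose P [:0, c:]"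
    by (simp add: P_def L_def pcompose_pCons flip: pcompose_assoc)
  \<comment> \<open>The coefficients of \<open>p\<close> are approximated up to \<open>r'\<close>, so that the substituted error is small.\<close>
  obtain r' where r': "r' \<noteq> 0" 
    "\<And>i j. i \<le> n \<Longrightarrow> j \<le> n \<Longrightarrow> r' * (Polynomial.coeff (L ^ i) j / (c * D)) \<in> Mv"
    using exists_common_small_factor[OF nontriv,
        of "(\<lambda>(i, j). Polynomial.coeff (L ^ i) j / (c * D)) ` ({..n} \<times> {..n})"] by fastforce
  have "\<exists>b\<in>K. (Polynomial.coeff p i - b) / r' \<in> Ov" for i
    by (rule vclosureD[OF p(3) r'(1)])
  then obtain b where b: "\<And>i. b i \<in> K" "\<And>i. (Polynomial.coeff p i - b i) / r' \<in> Ov" by metis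
  define q where "q = (\<Sum>i\<le>n. Polynomial.monom (b i) i)"
  have cq: "Polynomial.coeff q i = (if i \<le> n then b i else 0)" for i
    by (simp add: q_def coeff_sum)
  define e where "e i = b i - Polynomial.coeff p i" for i
  have e: "e i / r' \<in> Ov" for i
    using b(2)[of i] Ov_minus[of "(Polynomial.coeff p i - b i) / r'"]
    by (simp add: e_def minus_divide_left)
  have q_eq: "q = p + (\<Sum>i\<le>n. Polynomial.monom (e i) i)"
    by (rule poly_eqI) (auto simp: cq coeff_sum e_def coeff_eq_0 n_def)
  define G where "G = Polynomial.smult (inverse (c * D)) (pcompose q L)"
  have "pcompose (s ^ i) L = pcompose s L ^ i" for s i
    by (induction i) (simp_all add: pcompose_mult pcompose_1)
  then have "pcompose q L = pcompose P [:0, c:] + (\<Sum>i\<le>n. Polynomial.smult (e i) (L ^ i))"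
    by (simp add: q_eq pcompose_add pcompose_sum comp monom_altdef pcompose_smult pcompose_pCons)
  then have cG: "Polynomial.coeff G j = c ^ j * Polynomial.coeff P j / (c * D) +
      (\<Sum>i\<le>n. e i * Polynomial.coeff (L ^ i) j / (c * D))" for j
    by (simp add: G_def coeff_pcompose_linear coeff_sum sum_distrib_left divide_inverse
        distrib_left mult_ac)
  have dL: "Polynomial.coeff (L ^ i) j = 0" if "i \<le> n" "n < j" for i j
  proof (rule coeff_eq_0)
    have "Polynomial.degree (L ^ i) \<le> Polynomial.degree L * i" by (rule degree_power_le)
    also have "\<dots> \<le> i" using c(1) by (simp add: L_def)
    finally show "Polynomial.degree (L ^ i) < j" using that by simp
  qed
  have small: "(\<Sum>i\<le>n. e i * Polynomial.coeff (L ^ i) j / (c * D)) \<in> Mv" for j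
  proof (rule Mv_sum)
    fix i assume i: "i \<in> {..n}"
    have "r' * (Polynomial.coeff (L ^ i) j / (c * D)) \<in> Mv"
      using r'(2)[of i j] dL[of i j] i by (cases "j \<le> n") auto
    then have "(e i / r') * (r' * (Polynomial.coeff (L ^ i) j / (c * D))) \<in> Mv"
      by (rule Mv_mult2[OF e])
    then show "e i * Polynomial.coeff (L ^ i) j / (c * D) \<in> Mv" using r'(1) by simp
  qed
  have main: "c ^ j * Polynomial.coeff P j / (c * D) \<in> Mv" if j: "j \<noteq> 1" for j
  proof (cases "j = 0 \<or> n < j")
    case True
    then show ?thesis using P0 dP by (auto simp: coeff_eq_0)
  next
    case False
    then obtain k where k: "j = Suc (Suc k)" using j by (cases j rule: nat.exhaust; cases "j - 1") auto
    have "(c * (Polynomial.coeff P j / D)) * c ^ k \<in> Mv"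
      using c(3,4) False by (intro Mv_mult[OF c(4)] Ov_power Mv_imp_Ov) auto
    also have "(c * (Polynomial.coeff P j / D)) * c ^ k = c ^ j * Polynomial.coeff P j / (c * D)"
      using c(1) D by (simp add: k field_simps)
    finally show ?thesis .
  qed
  have G: "Polynomial.coeff G j \<in> Mv" if "j \<noteq> 1" for j
    unfolding cG by (intro Mv_add main small that)
  have "Polynomial.coeff G 1 - 1 \<in> Mv"
    unfolding cG P1 using small[of 1] c(1) D by simp
  moreover define m where "m = Polynomial.coeff G 1 - 1"
  ultimately have m: "m \<in> Mv" "Polynomial.coeff G 1 = 1 + m" by simp_all
  have "\<exists>a\<in>UNIV \<inter> Ov. poly G a = 0 \<and> 0 < v (a - 0)"
  proof (rule hens[unfolded henselian_def, rule_format])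
    show "Polynomial.coeff G i \<in> UNIV \<inter> Ov" for i
      using G[of i] m one_plus_Mv(2)[OF m(1)] by (cases "i = 1") (auto intro: Mv_imp_Ov)
    show "0 < v (poly G 0)" using G[of 0] by (simp add: poly_0_coeff_0 valuation_ideal_def)
    have "poly (pderiv G) 0 = 1 + m" using m(2) by (simp add: poly_0_coeff_0 coeff_pderiv)
    moreover have "w (1 + m) = 0"
      using one_plus_Mv[OF m(1)] by (auto simp: Ov_iff w_inverse)
    ultimately show "v (poly (pderiv G) 0) = 0"
      using one_plus_Mv(1)[OF m(1)] by (simp add: v_eq_Fin zero_extended_def)
  qed simp
  then obtain a where a: "a \<in> Ov" "poly G a = 0" by blast
  show ?thesis
  proof (intro exI conjI)
    show "q \<noteq> 0"
      using m one_plus_Mv(1)[OF m(1)] by (auto simp: G_def)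
    show "poly_over K q" using b(1) K by (simp add: poly_over_def cq)
    show "poly q (x + a * c) = 0"
      using a(2) c(1) D by (simp add: G_def poly_pcompose L_def)
    have "- ((c * inverse r) * a) \<in> Ov"
      using a(1) c(2) by (simp add: Ov_minus Ov_mult Mv_imp_Ov)
    then show "(x - (x + a * c)) / r \<in> Ov" by (simp add: divide_inverse mult_ac)
  qed
qed

text \<open>
  Choose a polynomial of least degree over the closure with the given root. Its derivative does not
  vanish at the root, in characteristic \<open>0\<close>, so the root is approximated by roots of polynomials over
  \<open>K\<close>. These lie in \<open>K\<close>.
\<close>

lemma acl_vclosure:
  assumes hens: "henselian v UNIV" and nontriv: "Mv \<noteq> {0}" and K: "acl K = K"
  shows "acl (vclosure K) = vclosure K"
proof
  have Kr: "ring_gen K = K" using ring_gen_subfield[OF subfield_acl[of K]] K by simp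
  show "acl (vclosure K) \<subseteq> vclosure K"
  proof
    fix x assume "x \<in> acl (vclosure K)"
    then have ex: "\<exists>p. p \<noteq> 0 \<and> poly_over (vclosure K) p \<and> poly p x = 0"
      by (simp add: acl_def algebraic_over_def ring_gen_vclosure[OF Kr])
    obtain p where p: "p \<noteq> 0" "poly_over (vclosure K) p" "poly p x = 0"
      and min: "\<And>q. q \<noteq> 0 \<and> poly_over (vclosure K) q \<and> poly q x = 0 \<Longrightarrow> Polynomial.degree p \<le> Polynomial.degree q"
      using ex_has_least_nat[of "\<lambda>p. p \<noteq> 0 \<and> poly_over (vclosure K) p \<and> poly p x = 0" _ Polynomial.degree] ex
      by metis
    have deg: "0 < Polynomial.degree p"
    proof (rule ccontr)
      assume "\<not> ?thesis"
      then obtain a where "p = [:a:]" by (auto elim: degree_eq_zeroE)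
      then show False using p by simp
    qed
    have nat: "of_nat k \<in> vclosure K" for k
      using ring_gen_zero[of "vclosure K"] ring_gen.one[of "vclosure K"] ring_gen_add[of _ "vclosure K"]
      unfolding ring_gen_vclosure[OF Kr] by (induction k) auto
    have "poly_over (vclosure K) (pderiv p)"
      using p(2) nat ring_gen.mult[of _ "vclosure K"]
      unfolding ring_gen_vclosure[OF Kr] poly_over_def coeff_pderiv by blast
    then have "poly (pderiv p) x \<noteq> 0"
      using min[of "pderiv p"] pderiv_neq_0[OF deg] pderiv_degree_less[OF deg] by auto
    then have app: "\<exists>q b. q \<noteq> 0 \<and> poly_over K q \<and> poly q b = 0 \<and> (x - b) / r \<in> Ov" if "r \<noteq> 0" for r
      using p ring_gen_zero[of K] that unfolding Kr
      by (intro root_of_approximating_polynomial[OF hens nontriv, of p]) (auto simp: poly_over_def)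
    show "x \<in> vclosure K"
      unfolding vclosure_def
    proof (intro CollectI allI impI)
      fix r :: 'a assume "r \<noteq> 0"
      then obtain q b where "q \<noteq> 0" "poly_over K q" "poly q b = 0" and b: "(x - b) / r \<in> Ov"
        using app by blast
      then have "b \<in> acl K" unfolding acl_def algebraic_over_def Kr by blast
      then show "\<exists>b\<in>K. (x - b) / r \<in> Ov" using K b by blast
    qed
  qed
qed (rule acl_superset)

text \<open>
  The root that Hensel's Lemma provides in the large field is algebraic over \<open>K\<close>.
\<close>

lemma henselian_if_acl_closed:
  assumes hens: "henselian v UNIV" and K: "acl K = K"
  shows "henselian v K"
  unfolding henselian_def
proof (intro allI impI)
  fix f b assume f: "\<forall>i. Polynomial.coeff f i \<in> K \<inter> Ov" "b \<in> K \<inter> Ov"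
    "0 < v (poly f b)" "v (poly (pderiv f) b) = 0"
  then obtain a where a: "a \<in> Ov" "poly f a = 0" "0 < v (a - b)"
    using hens[unfolded henselian_def, rule_format, of f b] by auto
  have "f \<noteq> 0" using f(4) by (auto simp: zero_extended_def)
  moreover have "poly_over K f" using f(1) by (simp add: poly_over_def)
  moreover have "ring_gen K = K" using ring_gen_subfield[OF subfield_acl[of K]] K by simp
  ultimately have "a \<in> acl K" using a(2) unfolding acl_def algebraic_over_def by auto
  then show "\<exists>a\<in>K \<inter> Ov. poly f a = 0 \<and> 0 < v (a - b)" using a K by blast
qed

section \<open>Simple transcendental extensions are not henselian\<close>

text \<open>
  The polynomial \<open>Z\<^sup>2 - (1 + y)\<close> has the approximate root \<open>1\<close>, with derivative \<open>2\<close>, a unit. But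
  \<open>1 + y\<close> is not a square in the rational function field \<open>K (y)\<close>: comparing degrees in
  \<open>p\<^sup>2 = (1 + y) q\<^sup>2\<close> gives an even number on the left and an odd one on the right.
\<close>

lemma not_henselian_simple_transcendental:
  assumes K: "subfield K (ring_on UNIV)" and y: "y \<in> positive" "y \<notin> acl K"
  shows "\<not> henselian v (fractions (ring_gen (insert y K)))"
proof
  let ?F = "fractions (ring_gen (insert y K))"
  assume hens: "henselian v ?F"
  have F: "subfield ?F (ring_on UNIV)" by (rule subfield_fractions)
  have Fr: "ring_gen ?F = ?F" by (rule ring_gen_subfield[OF F])
  have F1: "1 \<in> ?F" and F0: "0 \<in> ?F" using ring_gen.one[of ?F] ring_gen_zero[of ?F] Fr by auto
  have "y \<in> ?F" using ring_gen_subset_fractions[of "insert y K"] ring_gen.base[of y "insert y K"] by auto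
  then have Fy: "- (1 + y) \<in> ?F"
    using F1 ring_gen_add[of 1 ?F y] ring_gen_uminus[of "1 + y" ?F] Fr by simp
  have yM: "y \<in> Mv" using y(1) positiveD by blast
  define f where "f = [:- (1 + y), 0, 1:]"
  have "\<exists>a\<in>?F \<inter> Ov. poly f a = 0 \<and> 0 < v (a - 1)"
  proof (rule hens[unfolded henselian_def, rule_format])
    show "Polynomial.coeff f i \<in> ?F \<inter> Ov" for i
      using Fy F0 F1 one_plus_Mv(2)[OF yM] Ov_minus[of "1 + y"]
      by (auto simp: f_def coeff_pCons split: nat.splits)
    show "1 \<in> ?F \<inter> Ov" using F1 by simp
    have "poly f 1 = - y" by (simp add: f_def)
    then show "0 < v (poly f 1)" using yM Mv_minus[of y] by (simp add: valuation_ideal_def)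
    have "poly (pderiv f) 1 = of_nat 2" by (simp add: f_def pderiv_pCons)
    moreover have "(of_nat 2 :: 'a) \<noteq> 0" "(of_nat 2 :: 'a) \<notin> Mv" "(of_nat 2 :: 'a) \<in> Ov"
      by (rule of_nat_neq_0 of_nat_notin_Mv of_nat_in_Ov; simp)+
    ultimately show "v (poly (pderiv f) 1) = 0"
      by (auto simp: v_eq_Fin zero_extended_def Ov_iff Mv_iff)
  qed
  then obtain a where "a \<in> ?F" "poly f a = 0" by blast
  moreover have "poly f a = a ^ 2 - (1 + y)" by (simp add: f_def power2_eq_square)
  ultimately have a: "a \<in> ?F" "a ^ 2 = 1 + y" by simp_all
  then obtain A B where AB: "A \<in> ring_gen (insert y K)" "B \<in> ring_gen (insert y K)" "B \<noteq> 0" "a = A / B"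
    by (auto simp: fractions_def)
  have Kr: "ring_gen K = K" by (rule ring_gen_subfield[OF K])
  obtain p q where p: "poly_over K p" "A = poly p y" and q: "poly_over K q" "B = poly q y"
    using AB(1,2) unfolding ring_gen_insert Kr by blast
  have eq: "poly p y ^ 2 = (1 + y) * poly q y ^ 2"
    using a(2) AB(3,4) unfolding p(2) q(2) by (simp add: field_simps)
  define h where "h = p ^ 2 - [:1, 1:] * q ^ 2"
  have closed: "poly_over K (s * t)" if "poly_over K s" "poly_over K t" for s t
  proof -
    have "Polynomial.coeff (s * t) i \<in> ring_gen K" for i
      unfolding coeff_mult using that by (intro ring_gen_sum ring_gen.mult) (simp_all add: Kr poly_over_def)
    then show ?thesis by (simp add: Kr poly_over_def)
  qed
  have diff: "poly_over K (s - t)" if "poly_over K s" "poly_over K t" for s t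
    using that ring_gen.diff[of _ K] unfolding Kr by (auto simp: poly_over_def)
  have "poly_over K [:1, 1:]"
    using ring_gen.one[of K] ring_gen_zero[of K] unfolding Kr 
    by (simp add: poly_over_pCons) (simp add: poly_over_def)
  then have "poly_over K h" unfolding h_def power2_eq_square by (intro diff closed p q)
  moreover have "poly h y = 0" using eq by (simp add: h_def algebra_simps)
  ultimately have "h = 0" using y(2) unfolding acl_def algebraic_over_def Kr by blast
  then have sq: "p ^ 2 = [:1, 1:] * q ^ 2" by (simp add: h_def)
  have "q \<noteq> 0" using AB(3) q(2) by auto
  then have deg: "Polynomial.degree (p ^ 2) = 1 + Polynomial.degree (q ^ 2)"
    unfolding sq by (subst degree_mult_eq) auto
  moreover have "p \<noteq> 0" using deg by (cases "p = 0") simp_all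
  ultimately have "2 * Polynomial.degree p = 1 + 2 * Polynomial.degree q"
    using \<open>q \<noteq> 0\<close> by (simp add: degree_power_eq)
  then show False by presburger
qed

end

section \<open>Dense subfields\<close>

context residue_char_0
begin

text \<open>
  The differences \<open>d s = y (f s) - s\<close> take the place of the elements \<open>s\<close> of \<open>S\<close> other than the \<open>y k\<close>.
  If \<open>y k\<close> depended on the differences and the remaining \<open>y j\<close>, the exchange property would make some
  \<open>d s\<close>, and with it \<open>s\<close>, depend on other elements of \<open>S\<close>. The difference \<open>d s\<close> is as close to \<open>y (f s)\<close>
  as the value of \<open>s\<close> is large.
\<close>

lemma exists_independent_limits:
  assumes chain: "arch_chain S"
    and cofinal: "\<And>(k::nat) r. r \<noteq> 0 \<Longrightarrow> \<exists>s\<in>S. f s = k \<and> s / r \<in> Ov"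
  shows "\<exists>(y :: nat \<Rightarrow> 'a) D. inj y \<and> range y \<subseteq> positive \<and> acl.independent_over D (range y) \<and>
    (\<forall>k r. r \<noteq> 0 \<longrightarrow> (\<exists>d\<in>D. (y k - d) / r \<in> Ov))"
proof -
  have "\<exists>s\<in>S. f s = k" for k using cofinal[of 1 k] by auto
  then obtain y where y: "\<And>k. y k \<in> S" "\<And>k. f (y k) = k" by metis
  have inj: "inj y" by (rule inj_on_inverseI[of _ f]) (simp add: y(2))
  have pos: "range y \<subseteq> positive" using y(1) chain by (auto simp: arch_chain_def)
  have ind: "s \<notin> acl (S - {s})" if "s \<in> S" for s
    using arch_chain_independent[OF chain] that by (auto simp: acl.independent_over_def)
  define d where "d s = y (f s) - s" for s
  define D where "D = d ` (S - range y)"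
  have diff: "a - b \<in> acl A" if "a \<in> acl A" "b \<in> acl A" for a b A
    using subfield_acl[of A] that unfolding subfield_ring_on_iff by blast
  have step: "y k \<notin> acl (d ` F \<union> (range y - {y k}))" if "finite F" "F \<subseteq> S - range y" for F k
    using that
  proof (induction F)
    case empty
    have "range y - {y k} \<subseteq> S - {y k}" using y(1) by blast
    then show ?case using ind[OF y(1)[of k]] acl.cl_monoD by auto
  next
    case (insert s F)
    show ?case
    proof
      assume "y k \<in> acl (d ` insert s F \<union> (range y - {y k}))"
      then have "y k \<in> acl (insert (d s) (d ` F \<union> (range y - {y k})))" by simp
      moreover have "y k \<notin> acl (d ` F \<union> (range y - {y k}))" using insert by blast
      ultimately have ds: "d s \<in> acl (insert (y k) (d ` F \<union> (range y - {y k})))"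
        by (rule acl_exchange)
      have sub: "insert (y k) (d ` F \<union> (range y - {y k})) \<subseteq> acl (F \<union> range y)"
      proof -
        have "y j \<in> acl (F \<union> range y)" for j by (rule acl.cl_memI) blast
        moreover have "d z \<in> acl (F \<union> range y)" if "z \<in> F" for z
          unfolding d_def using that by (intro diff acl.cl_memI) auto
        ultimately show ?thesis by blast
      qed
      have "d s \<in> acl (F \<union> range y)" using ds acl.cl_least[OF sub] by blast
      moreover have "y (f s) \<in> acl (F \<union> range y)" by (rule acl.cl_memI) blast
      ultimately have "y (f s) - d s \<in> acl (F \<union> range y)" by (intro diff)
      then have "s \<in> acl (F \<union> range y)" by (simp add: d_def)
      moreover have "F \<union> range y \<subseteq> S - {s}" using insert y(1) by blast
      ultimately show False using ind[of s] insert.prems acl.cl_monoD by blast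
    qed
  qed
  have ind_D: "acl.independent_over D (range y)"
    unfolding acl.independent_over_def
  proof (intro ballI notI)
    fix z assume z: "z \<in> range y" "z \<in> acl (D \<union> (range y - {z}))"
    then obtain k where k: "z = y k" by blast
    obtain E where E: "finite E" "E \<subseteq> D \<union> (range y - {z})" "z \<in> acl E"
      using acl_finite_subset[OF z(2)] by blast
    have "finite (E \<inter> D)" "E \<inter> D \<subseteq> d ` (S - range y)" using E(1) by (auto simp: D_def)
    then obtain F where F: "finite F" "F \<subseteq> S - range y" "E \<inter> D = d ` F"
      using finite_subset_image[of "E \<inter> D" d "S - range y"] by metis
    have "E \<subseteq> d ` F \<union> (range y - {y k})" using E(2) F(3) k by blast
    then show False using step[OF F(1,2)] E(3) k acl.cl_monoD by blast
  qed
  \<comment> \<open>Zero is added to \<open>D\<close> for those bounds that, in the \<open>k\<close>-th part, are witnessed by \<open>y k\<close> itself.\<close>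
  have limit: "\<exists>a\<in>D \<union> {0}. (y k - a) / r \<in> Ov" if r: "r \<noteq> 0" for k r
  proof -
    obtain s where s: "s \<in> S" "f s = k" "s / r \<in> Ov" using cofinal[OF r] by blast
    show ?thesis
    proof (cases "s \<in> range y")
      case True
      then have "s = y k" using s(2) y(2) by auto
      then show ?thesis using s(3) by auto
    next
      case False
      then have "d s \<in> D" using s(1) by (auto simp: D_def)
      moreover have "y k - d s = s" using s(2) by (simp add: d_def)
      moreover have "(y k - d s) / r \<in> Ov" using s(3) calculation(2) by simp
      ultimately show ?thesis by blast
    qed
  qed
  have ind_D0: "acl.independent_over (D \<union> {0}) (range y)"
  proof -
    have "acl (D \<union> {0} \<union> A) \<subseteq> acl (D \<union> A)" for A
    proof (rule acl.cl_least)
      have "0 \<in> acl (D \<union> A)" using ring_gen_zero[of "acl (D \<union> A)"] ring_gen_subfield[OF subfield_acl] by auto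
      then show "D \<union> {0} \<union> A \<subseteq> acl (D \<union> A)" using acl.cl_superset[of "D \<union> A"] by blast
    qed
    then show ?thesis using ind_D unfolding acl.independent_over_def by blast
  qed
  show ?thesis
  proof (intro exI[of _ y] exI[of _ "D \<union> {0}"] conjI allI impI)
    show "inj y" "range y \<subseteq> positive" "acl.independent_over (D \<union> {0}) (range y)"
      by (fact inj pos ind_D0)+
    show "\<exists>a\<in>D \<union> {0}. (y k - a) / r \<in> Ov" if "r \<noteq> 0" for k r
      by (rule limit[OF that])
  qed
qed

text \<open>
  \<open>K\<close> is dense because its topological closure contains \<open>K\<close> and \<open>Y\<close> and is relatively algebraically
  closed.
\<close>

lemma exists_dense_flat:
  assumes hens: "henselian v UNIV" and nontriv: "Mv \<noteq> {0}"
    and limits: "\<And>y r. y \<in> Y \<Longrightarrow> r \<noteq> 0 \<Longrightarrow> \<exists>d\<in>D. (y - d) / r \<in> Ov"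
    and ind: "acl.independent_over D Y"
  shows "\<exists>K. acl K = K \<and> vclosure K = UNIV \<and> acl.independent_over K Y \<and> acl (K \<union> Y) = UNIV"
proof -
  obtain K where K: "D \<subseteq> K" "acl K = K" "acl.independent_over K Y" "acl (K \<union> Y) = UNIV"
    using acl.exists_spanning_complement[OF ind] by blast
  have "Y \<subseteq> vclosure K" using limits K(1) unfolding vclosure_def by blast
  then have "K \<union> Y \<subseteq> vclosure K" using subset_vclosure[of K] by blast
  then have "acl (K \<union> Y) \<subseteq> acl (vclosure K)" by (rule acl_mono)
  then have "vclosure K = UNIV" using K(4) acl_vclosure[OF hens nontriv K(2)] by blast
  then show ?thesis using K by blast
qed

lemma exists_dense_henselian:
  assumes hens: "henselian v UNIV"
    and K: "acl K = K" "vclosure K = UNIV" "acl.independent_over K Y" "acl (K \<union> Y) = UNIV"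
  shows "\<exists>K. subfield K (ring_on UNIV) \<and> dense_in_valued v K \<and> henselian v K \<and>
    trdeg UNIV K = (if finite Y then enat (card Y) else (\<infinity>::enat))"
proof (intro exI conjI)
  show F: "subfield K (ring_on UNIV)" using subfield_acl[of K] K(1) by simp
  show "dense_in_valued v K" by (rule dense_if_vclosure_UNIV[OF K(2)])
  show "henselian v K" by (rule henselian_if_acl_closed[OF hens K(1)])
  show "trdeg UNIV K = (if finite Y then enat (card Y) else (\<infinity>::enat))"
    by (rule trdeg_eq_card_basis[OF F K(3,4)])
qed

text \<open>
  The field \<open>K (y)\<close>. It lies between \<open>K\<close> and \<open>acl (insert y K)\<close>, so it inherits density from \<open>K\<close> and
  has \<open>Y\<close> as a basis of the whole field.
\<close>

lemma exists_dense_non_henselian: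
  assumes K: "acl K = K" "vclosure K = UNIV" "acl.independent_over K (insert y Y)"
      "acl (K \<union> insert y Y) = UNIV"
    and y: "y \<in> positive" "y \<notin> Y"
  shows "\<exists>K. subfield K (ring_on UNIV) \<and> dense_in_valued v K \<and> \<not> henselian v K \<and>
    trdeg UNIV K = (if finite Y then enat (card Y) else (\<infinity>::enat))"
proof (intro exI conjI)
  let ?F = "fractions (ring_gen (insert y K))"
  have KF: "subfield K (ring_on UNIV)" using subfield_acl[of K] K(1) by simp
  show F: "subfield ?F (ring_on UNIV)" by (rule subfield_fractions)
  have sup: "insert y K \<subseteq> ?F"
    using ring_gen_subset_fractions[of "insert y K"] by (auto intro: ring_gen.base)
  have sub: "?F \<subseteq> acl (insert y K)"
  proof
    fix x assume "x \<in> ?F"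
    then have "- x \<in> ?F" "0 \<in> ?F" "1 \<in> ?F"
      using ring_gen_uminus[of x ?F] ring_gen_zero[of ?F] ring_gen.one[of ?F]
      unfolding ring_gen_subfield[OF F] by auto
    then show "x \<in> acl (insert y K)"
      unfolding acl_eq_algebraic_over_fractions by (auto intro: algebraic_over_self)
  qed
  show "dense_in_valued v ?F"
    using K(2) sup by (intro dense_in_valuedI) (blast dest: vclosureD[of _ K, OF _ ])
  have "y \<notin> acl (K \<union> (insert y Y - {y}))" using K(3) unfolding acl.independent_over_def by blast
  then have "y \<notin> acl K" using acl.cl_monoD by blast
  then show "\<not> henselian v ?F" by (rule not_henselian_simple_transcendental[OF KF y(1)])
  have ind: "acl.independent_over ?F Y"
    unfolding acl.independent_over_def
  proof (intro ballI notI)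
    fix z assume z: "z \<in> Y" "z \<in> acl (?F \<union> (Y - {z}))"
    have "insert y K \<subseteq> K \<union> (insert y Y - {z})" using z(1) y(2) by blast
    then have "acl (insert y K) \<subseteq> acl (K \<union> (insert y Y - {z}))" by (rule acl_mono)
    then have "?F \<union> (Y - {z}) \<subseteq> acl (K \<union> (insert y Y - {z}))"
      using sub acl.cl_superset[of "K \<union> (insert y Y - {z})"] by blast
    then have "z \<in> acl (K \<union> (insert y Y - {z}))" using acl.cl_least z(2) by blast
    then show False using K(3) z(1) unfolding acl.independent_over_def by blast
  qed
  have "K \<union> insert y Y \<subseteq> ?F \<union> Y" using sup by blast
  then have "acl (?F \<union> Y) = UNIV" using K(4) acl_mono by blast
  then show "trdeg UNIV ?F = (if finite Y then enat (card Y) else (\<infinity>::enat))"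
    by (rule trdeg_eq_card_basis[OF F ind])
qed

end

theorem theorem2:
  fixes v :: "'a::field \<Rightarrow> 'g::linordered_ab_group_add extended"
  assumes "valuation v"
    and "value_group v \<noteq> {0}"
    and "henselian v UNIV"
    and "characteristic_zero (residue_field v)"
    and "\<not> (\<exists>C. maximal_proper_convex_subgroup C (value_group v))"
  shows "(\<forall>n::nat. 1 \<le> n \<longrightarrow>
            (\<exists>K. subfield K (ring_on UNIV) \<and> dense_in_valued v K \<and>
                 henselian v K \<and> trdeg UNIV K = enat n) \<and>
            (\<exists>K. subfield K (ring_on UNIV) \<and> dense_in_valued v K \<and>
                 \<not> henselian v K \<and> trdeg UNIV K = enat n)) \<and>
         (\<exists>K. subfield K (ring_on UNIV) \<and> dense_in_valued v K \<and>
              henselian v K \<and> trdeg UNIV K = (\<infinity>::enat)) \<and>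
         (\<exists>K. subfield K (ring_on UNIV) \<and> dense_in_valued v K \<and>
              \<not> henselian v K \<and> trdeg UNIV K = (\<infinity>::enat))"
proof -
  interpret residue_char_0 v
    by unfold_locales (fact assms)+
  have pos: "positive \<noteq> {}"
  proof -
    have "0 \<in> value_group v" by (auto simp: value_group_eq intro!: image_eqI[of _ _ 1])
    then obtain g where "g \<in> value_group v" "g \<noteq> 0" using assms(2) by blast
    then obtain x where x: "x \<noteq> 0" "w x \<noteq> 0" by (auto simp: value_group_eq)
    then have "x \<in> positive \<or> inverse x \<in> positive"
      using less_linear[of "w x" 0] by (auto simp: positive_def Mv_iff w_inverse)
    then show ?thesis by blast
  qed
  then have nontriv: "Mv \<noteq> {0}" by (auto simp: positive_def)
  obtain S and f :: "'a \<Rightarrow> nat" where S: "arch_chain S"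
    "\<And>k r. r \<noteq> 0 \<Longrightarrow> \<exists>s\<in>S. f s = k \<and> s / r \<in> Ov"
    using exists_cofinal_families[OF pos exists_arch_greater[OF assms(5)]] by metis
  obtain y :: "nat \<Rightarrow> 'a" and D where y: "inj y" "range y \<subseteq> positive" "acl.independent_over D (range y)"
    "\<And>k r. r \<noteq> 0 \<Longrightarrow> \<exists>d\<in>D. (y k - d) / r \<in> Ov"
    using exists_independent_limits[OF S] by metis
  \<comment> \<open>The index set \<open>I\<close> prescribes the transcendence basis, and thereby the degree.\<close>
  have flat: "\<exists>K. acl K = K \<and> vclosure K = UNIV \<and> acl.independent_over K (y ` I) \<and> acl (K \<union> y ` I) = UNIV"
    for I :: "nat set"
  proof (rule exists_dense_flat[OF assms(3) nontriv])
    show "acl.independent_over D (y ` I)"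
      by (rule acl.independent_over_subset[OF y(3)]) auto
    show "\<exists>d\<in>D. (z - d) / r \<in> Ov" if "z \<in> y ` I" "r \<noteq> 0" for z r
      using that y(4) by blast
  qed
  have card: "(if finite (y ` I) then enat (card (y ` I)) else (\<infinity>::enat)) = (if finite I then enat (card I) else (\<infinity>::enat))" for I :: "nat set"
    using y(1) by (simp add: finite_image_iff card_image inj_on_subset[OF y(1)])
  have hens: "\<exists>K. subfield K (ring_on UNIV) \<and> dense_in_valued v K \<and> henselian v K \<and>
    trdeg UNIV K = (if finite I then enat (card I) else (\<infinity>::enat))" for I :: "nat set"
    using flat[of I] exists_dense_henselian[OF assms(3), of _ "y ` I"] unfolding card by blast
  have non_hens: "\<exists>K. subfield K (ring_on UNIV) \<and> dense_in_valued v K \<and> \<not> henselian v K \<and>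
    trdeg UNIV K = (if finite I then enat (card I) else (\<infinity>::enat))" if "0 \<notin> I" for I :: "nat set"
  proof -
    obtain K where "acl K = K" "vclosure K = UNIV" "acl.independent_over K (insert (y 0) (y ` I))"
      "acl (K \<union> insert (y 0) (y ` I)) = UNIV"
      using flat[of "insert 0 I"] by auto
    moreover have "y 0 \<in> positive" "y 0 \<notin> y ` I" using y(1,2) that by (auto simp: inj_image_mem_iff)
    ultimately show ?thesis using exists_dense_non_henselian[of K "y 0" "y ` I"] unfolding card by blast
  qed
  show ?thesis
    using hens[of "{1..n}" for n] non_hens[of "{1..n}" for n] hens[of "{1..}"] non_hens[of "{1..}"]
    by (auto simp: infinite_Ici)
qed

end
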